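(* Let $\mathcal{C}$ be a congruence-modular equational class, let $A,B$ be algebras from $\mathcal{C}$ and let $f:A\to B$ be a morphism in $\mathcal{C}$. For each $\theta\in\mathrm{Con}(A)$, let $f_{[\theta]}:A/\theta\to B/Cg_B(f(\theta))$ be the morphism given by $f_{[\theta]}(a/\theta)=f(a)/Cg_B(f(\theta))$ for all $a\in A$. If $f$ is admissible, then the following are equivalent: (1) $f$ fulfills GU; (2) for all $\theta\in\mathrm{Con}(A)$, $f_{[\theta]}$ fulfills GU; (3) for all $\theta\in\mathrm{Spec}(A)$, $f_{[\theta]}$ fulfills GU; (4) for all $\theta\in\mathrm{Min}(A)$, $f_{[\theta]}$ fulfills GU; (5) $f_{[\mathrm{Ker}(f)]}$ fulfills GU.
   Context: An equational class (variety) $\mathcal{C}$ of algebras of a fixed type is congruence-modular if the congruence lattice $\mathrm{Con}(M)$ is modular for every member $M$ of $\mathcal{C}$. All algebras are non-empty; a morphism in $\mathcal{C}$ is a homomorphism between members of $\mathcal{C}$. For an algebra $M$, $\Delta_M$ is the equality relation and $\nabla_M=M^2$; for $X\subseteq M^2$, $Cg_M(X)$ is the congruence of $M$ generated by $X$. In a congruence-modular class, the commutator $[\alpha,\beta]_M$ of $\alpha,\beta\in\mathrm{Con}(M)$ is the (Freese--McKenzie) modular commutator, i.e. the smallest congruence $\delta$ of $M$ such that, for every term $t(\bar x,\bar y)$ and all tuples $\bar a,\bar b,\bar c,\bar d$ of elements of $M$ with $(a_i,b_i)\in\alpha$ for all $i$ and $(c_j,d_j)\in\beta$ for all $j$, $(t(\bar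 a,\bar c),t(\bar a,\bar d))\in\delta$ implies $(t(\bar b,\bar c),t(\bar b,\bar d))\in\delta$. A congruence $\phi\neq\nabla_M$ is prime if, for all $\alpha,\beta\in\mathrm{Con}(M)$, $[\alpha,\beta]_M\subseteq\phi$ implies $\alpha\subseteq\phi$ or $\beta\subseteq\phi$; $\mathrm{Spec}(M)$ is the set of prime congruences of $M$ and $\mathrm{Min}(M)$ is the set of minimal elements of $(\mathrm{Spec}(M),\subseteq)$. For a morphism $f:A\to B$, $\theta\in\mathrm{Con}(A)$ and $\psi\in\mathrm{Con}(B)$: $f(\theta)=\{(f(a),f(b)) : (a,b)\in\theta\}\subseteq B^2$, $f^*(\psi)=\{(x,y)\in A^2 : (f(x),f(y))\in\psi\}\in\mathrm{Con}(A)$ and $\mathrm{Ker}(f)=f^*(\Delta_B)$. $f$ is admissible if $f^*(\psi)\in\mathrm{Spec}(A)$ for all $\psi\in\mathrm{Spec}(B)$; if $f$ is admissible, then so is every $f_{[\theta]}$. An admissible morphism $f:A\to B$ fulfills GU (Going Up) if for all $\phi,\psi\in\mathrm{Spec}(A)$ and $\phi_1\in\mathrm{Spec}(B)$ with $\phi\subseteq\psi$ and $f^*(\phi_1)=\phi$ there is $\psi_1\in\mathrm{Spec}(B)$ with $\phi_1\subseteq\psi_1$ and $f^*(\psi_1)=\psi$. *)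

theory Defs
  imports "HOL-Algebra.Congruence"
begin

section \<open>Algebras of a fixed type, terms and equational classes\<close>

text \<open>
  A type of algebras is a set \<open>F\<close> of pairs (operation symbol, arity); \<open>F\<close> may be empty or infinite.
  The operation with symbol \<open>g\<close> and arity \<open>n\<close> of an algebra \<open>M\<close> is \<open>opr M g\<close>, restricted to the
  lists of length \<open>n\<close> over the carrier; all other values of \<open>opr M\<close> are irrelevant.
\<close>

record ('a, 'f) ualg = "'a partial_object" +
  opr :: "'f \<Rightarrow> 'a list \<Rightarrow> 'a"

definition algebra :: "('f \<times> nat) set \<Rightarrow> ('a, 'f) ualg \<Rightarrow> bool" where
  "algebra F M \<longleftrightarrow> carrier M \<noteq> {} \<and>
     (\<forall>g xs. (g, length xs) \<in> F \<and> set xs \<subseteq> carrier M \<longrightarrow> opr M g xs \<in> carrier M)"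

datatype ('f, 'v) trm = Var 'v | App 'f "('f, 'v) trm list"

fun wf_trm :: "('f \<times> nat) set \<Rightarrow> ('f, 'v) trm \<Rightarrow> bool" where
  "wf_trm F (Var x) \<longleftrightarrow> True"
| "wf_trm F (App g ts) \<longleftrightarrow> (g, length ts) \<in> F \<and> (\<forall>t \<in> set ts. wf_trm F t)"

fun eval :: "('a, 'f) ualg \<Rightarrow> ('v \<Rightarrow> 'a) \<Rightarrow> ('f, 'v) trm \<Rightarrow> 'a" where
  "eval M e (Var x) = e x"
| "eval M e (App g ts) = opr M g (map (eval M e) ts)"

definition identities :: "('f \<times> nat) set \<Rightarrow> (('f, nat) trm \<times> ('f, nat) trm) set" where
  "identities F = {(s, t). wf_trm F s \<and> wf_trm F t}"

definition variety ::
  "('f \<times> nat) set \<Rightarrow> (('f, nat) trm \<times> ('f, nat) trm) set \<Rightarrow> ('a, 'f) ualg set" where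
  "variety F E = {M. algebra F M \<and>
     (\<forall>(s, t) \<in> E. \<forall>e. range e \<subseteq> carrier M \<longrightarrow> eval M e s = eval M e t)}"

definition is_hom ::
  "('f \<times> nat) set \<Rightarrow> ('a, 'f) ualg \<Rightarrow> ('b, 'f) ualg \<Rightarrow> ('a \<Rightarrow> 'b) \<Rightarrow> bool" where
  "is_hom F A B f \<longleftrightarrow> f ` carrier A \<subseteq> carrier B \<and>
     (\<forall>g xs. (g, length xs) \<in> F \<and> set xs \<subseteq> carrier A \<longrightarrow> f (opr A g xs) = opr B g (map f xs))"


section \<open>Congruences and congruence-modularity\<close>

definition Con :: "('f \<times> nat) set \<Rightarrow> ('a, 'f) ualg \<Rightarrow> ('a \<times> 'a) set set" where
  "Con F M = {\<theta>. equiv (carrier M) \<theta> \<and>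
     (\<forall>g xs ys. (g, length xs) \<in> F \<and> list_all2 (\<lambda>x y. (x, y) \<in> \<theta>) xs ys
        \<longrightarrow> (opr M g xs, opr M g ys) \<in> \<theta>)}"

definition Cg :: "('f \<times> nat) set \<Rightarrow> ('a, 'f) ualg \<Rightarrow> ('a \<times> 'a) set \<Rightarrow> ('a \<times> 'a) set" where
  "Cg F M X = \<Inter>{\<theta> \<in> Con F M. X \<subseteq> \<theta>}"

text \<open>The lattice \<open>Con F M\<close> has meet \<open>\<alpha> \<inter> \<beta>\<close> and join \<open>Cg F M (\<alpha> \<union> \<beta>)\<close>.\<close>

definition con_modular :: "('f \<times> nat) set \<Rightarrow> ('a, 'f) ualg \<Rightarrow> bool" where
  "con_modular F M \<longleftrightarrow> (\<forall>\<alpha> \<in> Con F M. \<forall>\<beta> \<in> Con F M. \<forall>\<gamma> \<in> Con F M.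
     \<gamma> \<subseteq> \<alpha> \<longrightarrow> \<alpha> \<inter> Cg F M (\<beta> \<union> \<gamma>) = Cg F M ((\<alpha> \<inter> \<beta>) \<union> \<gamma>))"

text \<open>
  A formula cannot quantify over the types of the carriers, so the members of the class are taken
  here with carriers inside \<open>('f, nat) trm\<close>. This loses nothing: the lemma
  \<open>congruence_modular_con_modular\<close> below derives \<open>con_modular F M\<close> for the members \<open>M\<close>
  of the class over an arbitrary type. (A failure of the modular law involves only countably many
  elements, and the subalgebra generated by them is isomorphic to an algebra with carrier in
  \<open>('f, nat) trm\<close>.)
\<close>

definition congruence_modular ::
  "('f \<times> nat) set \<Rightarrow> (('f, nat) trm \<times> ('f, nat) trm) set \<Rightarrow> bool" where
  "congruence_modular F E \<longleftrightarrow>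
     (\<forall>M :: (('f, nat) trm, 'f) ualg. M \<in> variety F E \<longrightarrow> con_modular F M)"

lemma Con_opr:
  "\<theta> \<in> Con F M \<Longrightarrow> (g, length xs) \<in> F \<Longrightarrow> list_all2 (\<lambda>x y. (x, y) \<in> \<theta>) xs ys
    \<Longrightarrow> (opr M g xs, opr M g ys) \<in> \<theta>"
  unfolding Con_def by blast

lemma Con_equiv: "\<theta> \<in> Con F M \<Longrightarrow> equiv (carrier M) \<theta>"
  unfolding Con_def by blast

lemma Con_sub: "\<theta> \<in> Con F M \<Longrightarrow> \<theta> \<subseteq> carrier M \<times> carrier M"
  using Con_equiv equiv_def by blast

lemma list_all2_rel_sub:
  "list_all2 (\<lambda>x y. (x, y) \<in> \<theta>) xs ys \<Longrightarrow> \<theta> \<subseteq> A \<times> A \<Longrightarrow> set xs \<subseteq> A \<and> set ys \<subseteq> A"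
  by (induction rule: list_all2_induct) auto

lemma full_in_Con: "algebra F M \<Longrightarrow> carrier M \<times> carrier M \<in> Con F M"
  unfolding Con_def algebra_def
proof (clarify, intro conjI allI impI)
  show "equiv (carrier M) (carrier M \<times> carrier M)"
    by (auto simp: equiv_def refl_on_def sym_def trans_def)
next
  fix g and xs ys :: "'b list"
  assume a: "\<forall>g xs. (g, length xs) \<in> F \<and> set xs \<subseteq> carrier M \<longrightarrow> opr M g xs \<in> carrier M"
    "(g, length xs) \<in> F \<and> list_all2 (\<lambda>x y. (x, y) \<in> carrier M \<times> carrier M) xs ys"
  then have "set xs \<subseteq> carrier M" "set ys \<subseteq> carrier M" "length ys = length xs"
    using list_all2_rel_sub[of "carrier M \<times> carrier M" xs ys "carrier M"]
      list_all2_lengthD[of _ xs ys] by auto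
  then show "(opr M g xs, opr M g ys) \<in> carrier M \<times> carrier M"
    using a by auto
qed

lemma Inter_in_Con:
  assumes "S \<subseteq> Con F M" "S \<noteq> {}"
  shows "\<Inter>S \<in> Con F M"
proof -
  have "equiv (carrier M) (\<Inter>S)"
  proof (rule equivI)
    show "\<Inter>S \<subseteq> carrier M \<times> carrier M" using assms Con_sub by blast
    show "refl_on (carrier M) (\<Inter>S)"
      using assms Con_equiv by (fastforce simp: refl_on_def equiv_def)
    show "sym (\<Inter>S)"
      using assms Con_equiv by (fastforce simp: sym_def equiv_def)
    show "trans (\<Inter>S)"
      unfolding trans_def
    proof (intro allI impI InterI)
      fix x y z \<theta> assume "(x, y) \<in> \<Inter>S" "(y, z) \<in> \<Inter>S" "\<theta> \<in> S"
      moreover have "trans \<theta>" using \<open>\<theta> \<in> S\<close> assms Con_equiv by (auto simp: equiv_def)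
      ultimately show "(x, z) \<in> \<theta>" by (meson InterD transD)
    qed
  qed
  moreover have "(opr M g xs, opr M g ys) \<in> \<Inter>S"
    if "(g, length xs) \<in> F" "list_all2 (\<lambda>x y. (x, y) \<in> \<Inter>S) xs ys" for g xs ys
  proof (rule InterI)
    fix \<theta> assume "\<theta> \<in> S"
    then have "list_all2 (\<lambda>x y. (x, y) \<in> \<theta>) xs ys"
      using that(2) by (auto elim: list_all2_mono)
    then show "(opr M g xs, opr M g ys) \<in> \<theta>"
      using Con_opr[OF subsetD[OF assms(1) \<open>\<theta> \<in> S\<close>] that(1)] by simp
  qed
  ultimately show ?thesis unfolding Con_def by blast
qed

lemma Cg_in_Con: "algebra F M \<Longrightarrow> X \<subseteq> carrier M \<times> carrier M \<Longrightarrow> Cg F M X \<in> Con F M"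
  unfolding Cg_def by (rule Inter_in_Con) (use full_in_Con in auto)

lemma Cg_upper: "X \<subseteq> Cg F M X"
  unfolding Cg_def by blast

lemma Cg_least: "\<theta> \<in> Con F M \<Longrightarrow> X \<subseteq> \<theta> \<Longrightarrow> Cg F M X \<subseteq> \<theta>"
  unfolding Cg_def by blast

lemma Inter2_in_Con: "\<alpha> \<in> Con F M \<Longrightarrow> \<beta> \<in> Con F M \<Longrightarrow> \<alpha> \<inter> \<beta> \<in> Con F M"
  using Inter_in_Con[of "{\<alpha>, \<beta>}" F M] by auto

lemma eval_closed:
  assumes "algebra F M" "range e \<subseteq> carrier M"
  shows "wf_trm F t \<Longrightarrow> eval M e t \<in> carrier M"
proof (induction t)
  case (Var x)
  then show ?case using assms by auto
next
  case (App g ts)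
  then have "set (map (eval M e) ts) \<subseteq> carrier M" "(g, length (map (eval M e) ts)) \<in> F" by auto
  then show ?case using assms(1) unfolding algebra_def by auto
qed

lemma eval_hom:
  assumes "is_hom F N M h" "algebra F N" "range e \<subseteq> carrier N"
  shows "wf_trm F t \<Longrightarrow> h (eval N e t) = eval M (h \<circ> e) t"
proof (induction t)
  case (Var x)
  then show ?case by auto
next
  case (App g ts)
  then have *: "set (map (eval N e) ts) \<subseteq> carrier N" "(g, length (map (eval N e) ts)) \<in> F"
    using eval_closed[OF assms(2,3)] by auto
  then have "h (eval N e (App g ts)) = opr M g (map h (map (eval N e) ts))"
    using assms(1) unfolding is_hom_def by auto
  also have "map h (map (eval N e) ts) = map (eval M (h \<circ> e)) ts" using App by (simp add: o_def)
  finally show ?case by (simp add: o_def)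
qed


section \<open>Inverse images, the commutator and prime congruences\<close>

definition pullback :: "('a, 'f) ualg \<Rightarrow> ('a \<Rightarrow> 'b) \<Rightarrow> ('b \<times> 'b) set \<Rightarrow> ('a \<times> 'a) set" where
  "pullback A f \<psi> = {(x, y) \<in> carrier A \<times> carrier A. (f x, f y) \<in> \<psi>}"

definition Ker :: "('a, 'f) ualg \<Rightarrow> ('b, 'f) ualg \<Rightarrow> ('a \<Rightarrow> 'b) \<Rightarrow> ('a \<times> 'a) set" where
  "Ker A B f = pullback A f (Id_on (carrier B))"

text \<open>
  In a term \<open>t(x, y)\<close> the variables \<open>Inl i\<close> are those of the first tuple and the variables
  \<open>Inr j\<close> those of the second; only finitely many of them occur in \<open>t\<close>, so that infinite sequences
  of arguments amount to tuples.
\<close>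

definition term_condition ::
  "('f \<times> nat) set \<Rightarrow> ('a, 'f) ualg \<Rightarrow> ('a \<times> 'a) set \<Rightarrow> ('a \<times> 'a) set \<Rightarrow> ('a \<times> 'a) set \<Rightarrow> bool"
  where
  "term_condition F M \<alpha> \<beta> \<delta> \<longleftrightarrow>
     (\<forall>(t :: ('f, nat + nat) trm) a b c d.
        wf_trm F t \<and> (\<forall>i. (a i, b i) \<in> \<alpha>) \<and> (\<forall>j. (c j, d j) \<in> \<beta>) \<and>
        (eval M (case_sum a c) t, eval M (case_sum a d) t) \<in> \<delta>
        \<longrightarrow> (eval M (case_sum b c) t, eval M (case_sum b d) t) \<in> \<delta>)"

definition commutator ::
  "('f \<times> nat) set \<Rightarrow> ('a, 'f) ualg \<Rightarrow> ('a \<times> 'a) set \<Rightarrow> ('a \<times> 'a) set \<Rightarrow> ('a \<times> 'a) set" where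
  "commutator F M \<alpha> \<beta> = \<Inter>{\<delta> \<in> Con F M. term_condition F M \<alpha> \<beta> \<delta>}"

definition Spec :: "('f \<times> nat) set \<Rightarrow> ('a, 'f) ualg \<Rightarrow> ('a \<times> 'a) set set" where
  "Spec F M = {\<phi> \<in> Con F M. \<phi> \<noteq> carrier M \<times> carrier M \<and>
     (\<forall>\<alpha> \<in> Con F M. \<forall>\<beta> \<in> Con F M. commutator F M \<alpha> \<beta> \<subseteq> \<phi> \<longrightarrow> \<alpha> \<subseteq> \<phi> \<or> \<beta> \<subseteq> \<phi>)}"

definition MinSpec :: "('f \<times> nat) set \<Rightarrow> ('a, 'f) ualg \<Rightarrow> ('a \<times> 'a) set set" where
  "MinSpec F M = {\<phi> \<in> Spec F M. \<forall>\<psi> \<in> Spec F M. \<psi> \<subseteq> \<phi> \<longrightarrow> \<psi> = \<phi>}"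

definition admissible ::
  "('f \<times> nat) set \<Rightarrow> ('a, 'f) ualg \<Rightarrow> ('b, 'f) ualg \<Rightarrow> ('a \<Rightarrow> 'b) \<Rightarrow> bool" where
  "admissible F A B f \<longleftrightarrow> (\<forall>\<psi> \<in> Spec F B. pullback A f \<psi> \<in> Spec F A)"

text \<open>Going Up is a property of admissible morphisms only.\<close>

definition GU ::
  "('f \<times> nat) set \<Rightarrow> ('a, 'f) ualg \<Rightarrow> ('b, 'f) ualg \<Rightarrow> ('a \<Rightarrow> 'b) \<Rightarrow> bool" where
  "GU F A B f \<longleftrightarrow> admissible F A B f \<and>
     (\<forall>\<phi> \<in> Spec F A. \<forall>\<psi> \<in> Spec F A. \<forall>\<phi>\<^sub>1 \<in> Spec F B.
        \<phi> \<subseteq> \<psi> \<and> pullback A f \<phi>\<^sub>1 = \<phi> \<longrightarrow>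
        (\<exists>\<psi>\<^sub>1 \<in> Spec F B. \<phi>\<^sub>1 \<subseteq> \<psi>\<^sub>1 \<and> pullback A f \<psi>\<^sub>1 = \<psi>))"

lemma full_term_condition:
  fixes F :: "('f \<times> nat) set" and M :: "('a, 'f) ualg"
  assumes "algebra F M" "\<alpha> \<in> Con F M" "\<beta> \<in> Con F M"
  shows "term_condition F M \<alpha> \<beta> (carrier M \<times> carrier M)"
  unfolding term_condition_def
proof (intro allI impI, elim conjE)
  fix t :: "('f, nat + nat) trm" and a b c d :: "nat \<Rightarrow> 'a"
  assume t: "wf_trm F t" and ab: "\<forall>i. (a i, b i) \<in> \<alpha>" and cd: "\<forall>j. (c j, d j) \<in> \<beta>"
  have "b i \<in> carrier M" "c i \<in> carrier M" "d i \<in> carrier M" for i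
    using ab cd Con_sub[OF assms(2)] Con_sub[OF assms(3)] by blast+
  then have "range (case_sum b c) \<subseteq> carrier M" "range (case_sum b d) \<subseteq> carrier M"
    by (auto split: sum.splits)
  then show "(eval M (case_sum b c) t, eval M (case_sum b d) t) \<in> carrier M \<times> carrier M"
    using eval_closed[OF assms(1) _ t] by blast
qed

text \<open>The intersection defining the commutator is indeed a smallest element.\<close>

lemma commutator_smallest:
  fixes F :: "('f \<times> nat) set" and M :: "('a, 'f) ualg"
  assumes "algebra F M" "\<alpha> \<in> Con F M" "\<beta> \<in> Con F M"
  shows "commutator F M \<alpha> \<beta> \<in> Con F M"
    and "term_condition F M \<alpha> \<beta> (commutator F M \<alpha> \<beta>)"
    and "\<delta> \<in> Con F M \<Longrightarrow> term_condition F M \<alpha> \<beta> \<delta> \<Longrightarrow> commutator F M \<alpha> \<beta> \<subseteq> \<delta>"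
proof -
  show "commutator F M \<alpha> \<beta> \<in> Con F M"
    unfolding commutator_def
    by (rule Inter_in_Con) (use full_in_Con[OF assms(1)] full_term_condition[OF assms] in auto)
  show "term_condition F M \<alpha> \<beta> (commutator F M \<alpha> \<beta>)"
    unfolding term_condition_def[of _ _ _ _ "commutator F M \<alpha> \<beta>"] unfolding commutator_def
  proof (intro allI impI InterI, elim conjE)
    fix t :: "('f, nat + nat) trm" and a b c d :: "nat \<Rightarrow> 'a" and \<delta>
    assume "wf_trm F t" "\<forall>i. (a i, b i) \<in> \<alpha>" "\<forall>j. (c j, d j) \<in> \<beta>"
      "(eval M (case_sum a c) t, eval M (case_sum a d) t)
        \<in> \<Inter>{\<delta> \<in> Con F M. term_condition F M \<alpha> \<beta> \<delta>}"
      "\<delta> \<in> {\<delta> \<in> Con F M. term_condition F M \<alpha> \<beta> \<delta>}"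
    then show "(eval M (case_sum b c) t, eval M (case_sum b d) t) \<in> \<delta>"
      unfolding term_condition_def by blast
  qed
  show "\<delta> \<in> Con F M \<Longrightarrow> term_condition F M \<alpha> \<beta> \<delta> \<Longrightarrow> commutator F M \<alpha> \<beta> \<subseteq> \<delta>"
    unfolding commutator_def by blast
qed


section \<open>Quotient algebras and the morphisms between them\<close>

definition quot_alg :: "('a, 'f) ualg \<Rightarrow> ('a \<times> 'a) set \<Rightarrow> ('a set, 'f) ualg" where
  "quot_alg M \<theta> = \<lparr>carrier = carrier M // \<theta>,
     opr = (\<lambda>g Xs. \<theta> `` {opr M g (map (\<lambda>X. SOME x. x \<in> X) Xs)})\<rparr>"

text \<open>
  \<open>push F B f \<theta>\<close> is the congruence \<open>Cg\<^sub>B(f(\<theta>))\<close>, and \<open>induced F B f \<theta>\<close> is the morphism from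
  \<open>A/\<theta>\<close> to \<open>B/Cg\<^sub>B(f(\<theta>))\<close> with \<open>a/\<theta> \<mapsto> f(a)/Cg\<^sub>B(f(\<theta>))\<close>, see \<open>induced_class\<close> below.
\<close>

definition push :: "('f \<times> nat) set \<Rightarrow> ('b, 'f) ualg \<Rightarrow> ('a \<Rightarrow> 'b) \<Rightarrow> ('a \<times> 'a) set \<Rightarrow> ('b \<times> 'b) set"
  where "push F B f \<theta> = Cg F B (map_prod f f ` \<theta>)"

definition induced ::
  "('f \<times> nat) set \<Rightarrow> ('b, 'f) ualg \<Rightarrow> ('a \<Rightarrow> 'b) \<Rightarrow> ('a \<times> 'a) set \<Rightarrow> 'a set \<Rightarrow> 'b set" where
  "induced F B f \<theta> X = push F B f \<theta> `` {f (SOME x. x \<in> X)}"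

definition GU_induced ::
  "('f \<times> nat) set \<Rightarrow> ('a, 'f) ualg \<Rightarrow> ('b, 'f) ualg \<Rightarrow> ('a \<Rightarrow> 'b) \<Rightarrow> ('a \<times> 'a) set \<Rightarrow> bool" where
  "GU_induced F A B f \<theta> \<longleftrightarrow>
     GU F (quot_alg A \<theta>) (quot_alg B (push F B f \<theta>)) (induced F B f \<theta>)"

text \<open>The choices of representatives above are immaterial.\<close>

lemma class_rep:
  assumes "\<theta> \<in> Con F M" "x \<in> carrier M"
  shows "(SOME y. y \<in> \<theta> `` {x}, x) \<in> \<theta>"
proof -
  have "x \<in> \<theta> `` {x}" using Con_equiv[OF assms(1)] assms(2) equiv_class_self by fastforce
  then have "(SOME y. y \<in> \<theta> `` {x}) \<in> \<theta> `` {x}" by (rule someI)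
  then show ?thesis using Con_equiv[OF assms(1)] by (auto simp: equiv_def sym_def)
qed

lemma quot_alg_opr:
  assumes "\<theta> \<in> Con F M" "(g, length xs) \<in> F" "set xs \<subseteq> carrier M"
  shows "opr (quot_alg M \<theta>) g (map (\<lambda>x. \<theta> `` {x}) xs) = \<theta> `` {opr M g xs}"
proof -
  let ?ys = "map (\<lambda>X. SOME x. x \<in> X) (map (\<lambda>x. \<theta> `` {x}) xs)"
  have "list_all2 (\<lambda>x y. (x, y) \<in> \<theta>) ?ys xs"
    using assms(3) class_rep[OF assms(1)]
    by (auto simp: list_all2_conv_all_nth nth_mem subset_iff simp del: Image_singleton_iff)
  then have "(opr M g ?ys, opr M g xs) \<in> \<theta>" using Con_opr[OF assms(1)] assms(2) by auto
  then show ?thesis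
    using equiv_class_eq[OF Con_equiv[OF assms(1)]] by (simp add: quot_alg_def)
qed

lemma quot_alg_carrier: "carrier (quot_alg M \<theta>) = (\<lambda>x. \<theta> `` {x}) ` carrier M"
  by (auto simp: quot_alg_def quotient_def)

lemma induced_class:
  assumes "is_hom F A B f" "algebra F B" "\<theta> \<in> Con F A" "x \<in> carrier A"
  shows "induced F B f \<theta> (\<theta> `` {x}) = push F B f \<theta> `` {f x}"
proof -
  have "map_prod f f ` \<theta> \<subseteq> carrier B \<times> carrier B"
    using Con_sub[OF assms(3)] assms(1) by (fastforce simp: is_hom_def)
  then have "push F B f \<theta> \<in> Con F B" unfolding push_def by (rule Cg_in_Con[OF assms(2)])
  moreover have "(f (SOME y. y \<in> \<theta> `` {x}), f x) \<in> push F B f \<theta>"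
    using class_rep[OF assms(3,4)] Cg_upper unfolding push_def by fastforce
  ultimately show ?thesis unfolding induced_def by (rule equiv_class_eq[OF Con_equiv])
qed


section \<open>Independence of congruence-modularity from the type of the carriers\<close>

lemma pullback_in_Con:
  assumes "is_hom F N M h" "algebra F N" "\<theta> \<in> Con F M"
  shows "pullback N h \<theta> \<in> Con F N"
proof -
  note e = Con_equiv[OF assms(3)]
  have "equiv (carrier N) (pullback N h \<theta>)"
  proof (rule equivI)
    show "refl_on (carrier N) (pullback N h \<theta>)"
      using e assms(1) by (auto simp: is_hom_def equiv_def refl_on_def pullback_def)
    show "sym (pullback N h \<theta>)"
      using e by (auto simp: equiv_def sym_def pullback_def)
    show "trans (pullback N h \<theta>)"
      using e unfolding equiv_def trans_def pullback_def by blast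
  qed (auto simp: pullback_def)
  moreover have "(opr N g xs, opr N g ys) \<in> pullback N h \<theta>"
    if g: "(g, length xs) \<in> F" and l: "list_all2 (\<lambda>x y. (x, y) \<in> pullback N h \<theta>) xs ys" for g xs ys
  proof -
    have s: "set xs \<subseteq> carrier N" "set ys \<subseteq> carrier N"
      using list_all2_rel_sub[OF l, of "carrier N"] by (auto simp: pullback_def)
    have len: "length ys = length xs" using l list_all2_lengthD by metis
    have "list_all2 (\<lambda>x y. (x, y) \<in> \<theta>) (map h xs) (map h ys)"
      using l by (auto simp: list_all2_conv_all_nth pullback_def)
    then have "(opr M g (map h xs), opr M g (map h ys)) \<in> \<theta>"
      using Con_opr[OF assms(3)] g by auto
    then have "(h (opr N g xs), h (opr N g ys)) \<in> \<theta>"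
      using assms(1) g s len unfolding is_hom_def by auto
    then show ?thesis using assms(2) g s len unfolding pullback_def algebra_def by auto
  qed
  ultimately show ?thesis unfolding Con_def by blast
qed

lemma Cg_Un_subset_rtrancl:
  assumes M: "algebra F M" and \<beta>: "\<beta> \<in> Con F M" and \<gamma>: "\<gamma> \<in> Con F M"
  shows "Cg F M (\<beta> \<union> \<gamma>) \<subseteq> (\<beta> \<union> \<gamma>)\<^sup>*"
proof -
  let ?R = "(\<beta> \<union> \<gamma>)\<^sup>*" and ?C = "carrier M"
  let ?D = "?R \<inter> ?C \<times> ?C"
  have sub: "\<beta> \<union> \<gamma> \<subseteq> ?C \<times> ?C" using Con_sub \<beta> \<gamma> by blast
  have "sym (\<beta> \<union> \<gamma>)" using Con_equiv[OF \<beta>] Con_equiv[OF \<gamma>] by (auto simp: equiv_def sym_def)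
  then have "sym ?R" by (rule sym_rtrancl)
  then have "sym ?D" by (auto simp: sym_def)
  moreover have "trans ?D" unfolding trans_def by (auto intro: rtrancl_trans)
  ultimately have eq: "equiv ?C ?D" by (intro equivI) (auto simp: refl_on_def)
  have one: "(opr M g (ps @ u # qs), opr M g (ps @ v # qs)) \<in> ?R"
    if g: "(g, length (ps @ u # qs)) \<in> F" and pq: "set ps \<subseteq> ?C" "set qs \<subseteq> ?C"
      and uv: "(u, v) \<in> ?R" for g ps qs u v
    using uv
  proof (induction rule: rtrancl_induct)
    case (step y z)
    have "(opr M g (ps @ y # qs), opr M g (ps @ z # qs)) \<in> \<theta>"
      if th: "\<theta> \<in> Con F M" "(y, z) \<in> \<theta>" for \<theta>
    proof (rule Con_opr[OF th(1)])
      have r: "(x, x) \<in> \<theta>" if "x \<in> ?C" for x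
        using Con_equiv[OF th(1)] that by (auto simp: equiv_def refl_on_def)
      have "list_all2 (\<lambda>x y. (x, y) \<in> \<theta>) ps ps" "list_all2 (\<lambda>x y. (x, y) \<in> \<theta>) qs qs"
        using pq r by (auto intro!: list_all2_refl simp: list.rel_refl_strong subset_iff)
      then show "list_all2 (\<lambda>x y. (x, y) \<in> \<theta>) (ps @ y # qs) (ps @ z # qs)"
        using th(2) by (auto intro: list_all2_appendI)
    qed (use g in simp)
    then have "(opr M g (ps @ y # qs), opr M g (ps @ z # qs)) \<in> \<beta> \<union> \<gamma>"
      using step(2) \<beta> \<gamma> by blast
    then show ?case using step.IH by (rule rtrancl_into_rtrancl[rotated])
  qed simp
  have many: "(opr M g (ps @ xs), opr M g (ps @ ys)) \<in> ?R"
    if "list_all2 (\<lambda>x y. (x, y) \<in> ?D) xs ys" "(g, length (ps @ xs)) \<in> F" "set ps \<subseteq> ?C" for g ps xs ys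
    using that
  proof (induction arbitrary: ps rule: list_all2_induct)
    case (Cons x xs y ys)
    have xs: "set xs \<subseteq> ?C" using list_all2_rel_sub[OF Cons(2), of ?C] by auto
    have "(opr M g (ps @ x # xs), opr M g (ps @ y # xs)) \<in> ?R"
      using one[of g ps x xs y] Cons.prems Cons.hyps xs by auto
    moreover have "(opr M g ((ps @ [y]) @ xs), opr M g ((ps @ [y]) @ ys)) \<in> ?R"
      by (rule Cons.IH) (use Cons.prems Cons.hyps in auto)
    ultimately show ?case by (auto intro: rtrancl_trans)
  qed simp
  have "(opr M g xs, opr M g ys) \<in> ?D"
    if "(g, length xs) \<in> F" "list_all2 (\<lambda>x y. (x, y) \<in> ?D) xs ys" for g xs ys
  proof -
    have "set xs \<subseteq> ?C" "set ys \<subseteq> ?C" "length ys = length xs"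
      using list_all2_rel_sub[OF that(2), of ?C] list_all2_lengthD[OF that(2)] by auto
    then show ?thesis using many[OF that(2), of g "[]"] that(1) M unfolding algebra_def by auto
  qed
  then have "?D \<in> Con F M" using eq unfolding Con_def by blast
  then have "Cg F M (\<beta> \<union> \<gamma>) \<subseteq> ?D" by (rule Cg_least) (use sub in auto)
  then show ?thesis by blast
qed

lemma modular_step:
  fixes F :: "('f \<times> nat) set" and M :: "('a, 'f) ualg"
  assumes wfE: "E \<subseteq> identities F" and mod: "congruence_modular F E" and MV: "M \<in> variety F E"
    and \<alpha>: "\<alpha> \<in> Con F M" and \<beta>: "\<beta> \<in> Con F M" and \<gamma>: "\<gamma> \<in> Con F M" and \<gamma>\<alpha>: "\<gamma> \<subseteq> \<alpha>"
    and xy: "(x, y) \<in> \<alpha>" "(x, y) \<in> Cg F M (\<beta> \<union> \<gamma>)"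
  shows "(x, y) \<in> Cg F M ((\<alpha> \<inter> \<beta>) \<union> \<gamma>)"
proof -
  let ?C = "carrier M"
  have M: "algebra F M" using MV by (simp add: variety_def)
  obtain z n where z: "z 0 = x" "z n = y" "\<And>i. i < n \<Longrightarrow> (z i, z (Suc i)) \<in> \<beta> \<union> \<gamma>"
  proof -
    have "(x, y) \<in> (\<beta> \<union> \<gamma>)\<^sup>*" using Cg_Un_subset_rtrancl[OF M \<beta> \<gamma>] xy(2) by (rule subsetD)
    then obtain n where "(x, y) \<in> (\<beta> \<union> \<gamma>) ^^ n" using rtrancl_imp_relpow by blast
    then obtain z where "z 0 = x" "z n = y" "\<forall>i<n. (z i, z (Suc i)) \<in> \<beta> \<union> \<gamma>"
      unfolding relpow_fun_conv by blast
    then show thesis using that by blast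
  qed
  have xyC: "x \<in> ?C" "y \<in> ?C" using xy(1) Con_sub[OF \<alpha>] by auto
  have zC: "z i \<in> ?C" if "i \<le> n" for i
  proof (cases i)
    case 0
    then show ?thesis using z(1) xyC by simp
  next
    case (Suc j)
    then have "(z j, z i) \<in> \<beta> \<union> \<gamma>" using z(3) that by auto
    then show ?thesis using Con_sub[OF \<beta>] Con_sub[OF \<gamma>] by blast
  qed
  define e where "e i = z (min i n)" for i
  have eC: "range e \<subseteq> ?C" using zC by (auto simp: e_def)
  define T where "T = {t :: ('f, nat) trm. wf_trm F t}"
  define h where "h = eval M e"
  define k where "k = inv_into T h"
  define N where "N = \<lparr>carrier = k ` h ` T, opr = (\<lambda>g ts. k (h (App g ts)))\<rparr>"
  have hk: "h (k a) = a" "k a \<in> T" if "a \<in> h ` T" for a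
    using that unfolding k_def by (auto simp: f_inv_into_f inv_into_into)
  have hC: "h t \<in> ?C" if "t \<in> T" for t
    using eval_closed[OF M eC] that by (auto simp: h_def T_def)
  have NT: "carrier N \<subseteq> T" using hk by (auto simp: N_def)
  have AppT: "App g ts \<in> T" if "(g, length ts) \<in> F" "set ts \<subseteq> carrier N" for g ts
    using that NT by (auto simp: T_def)
  have N: "algebra F N"
    unfolding algebra_def
  proof (intro conjI allI impI)
    have "Var 0 \<in> T" by (simp add: T_def)
    then show "carrier N \<noteq> {}" by (auto simp: N_def)
  next
    fix g ts assume "(g, length ts) \<in> F \<and> set ts \<subseteq> carrier N"
    then show "opr N g ts \<in> carrier N" using AppT by (auto simp: N_def)
  qed
  have hom: "is_hom F N M h"
    unfolding is_hom_def
  proof (intro conjI allI impI)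
    show "h ` carrier N \<subseteq> ?C" using NT hC by auto
  next
    fix g ts assume "(g, length ts) \<in> F \<and> set ts \<subseteq> carrier N"
    then have "h (opr N g ts) = h (App g ts)" using AppT hk(1) by (auto simp: N_def)
    then show "h (opr N g ts) = opr M g (map h ts)" by (simp add: h_def)
  qed
  have inj: "s = t" if "s \<in> carrier N" "t \<in> carrier N" "h s = h t" for s t
    using that hk(1) by (force simp: N_def)
  have "N \<in> variety F E"
    unfolding variety_def
  proof (clarify, intro conjI N, clarify)
    fix s t and d :: "nat \<Rightarrow> ('f, nat) trm"
    assume st: "(s, t) \<in> E" and d: "range d \<subseteq> carrier N"
    have wf: "wf_trm F s" "wf_trm F t" using st wfE by (auto simp: identities_def)
    have "range (h \<circ> d) \<subseteq> ?C" using d hom by (auto simp: is_hom_def)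
    then have "eval M (h \<circ> d) s = eval M (h \<circ> d) t" using MV st unfolding variety_def by blast
    then have "h (eval N d s) = h (eval N d t)" using eval_hom[OF hom N d] wf by simp
    then show "eval N d s = eval N d t" using inj eval_closed[OF N d] wf by blast
  qed
  then have modN: "con_modular F N" using mod unfolding congruence_modular_def by blast
  let ?p = "pullback N h"
  have p: "?p \<alpha> \<in> Con F N" "?p \<beta> \<in> Con F N" "?p \<gamma> \<in> Con F N"
    using pullback_in_Con[OF hom N] \<alpha> \<beta> \<gamma> by auto
  have "?p \<gamma> \<subseteq> ?p \<alpha>" using \<gamma>\<alpha> by (auto simp: pullback_def)
  then have law: "?p \<alpha> \<inter> Cg F N (?p \<beta> \<union> ?p \<gamma>) = Cg F N ((?p \<alpha> \<inter> ?p \<beta>) \<union> ?p \<gamma>)"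
    using modN p unfolding con_modular_def by blast
  have zT: "z i \<in> h ` T" if "i \<le> n" for i
  proof -
    have "h (Var i) = z i" "Var i \<in> T" using that by (auto simp: h_def e_def T_def)
    then show ?thesis by (metis imageI)
  qed
  have kN: "k (z i) \<in> carrier N" if "i \<le> n" for i using zT that by (auto simp: N_def)
  let ?J = "Cg F N (?p \<beta> \<union> ?p \<gamma>)"
  have J: "?J \<in> Con F N" by (rule Cg_in_Con[OF N]) (auto simp: pullback_def)
  have "(k (z 0), k (z i)) \<in> ?J" if "i \<le> n" for i
    using that
  proof (induction i)
    case 0
    then show ?case using Con_equiv[OF J] kN[of 0] by (auto simp: equiv_def refl_on_def)
  next
    case (Suc i)
    then have "(k (z i), k (z (Suc i))) \<in> ?p \<beta> \<union> ?p \<gamma>"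
      using z(3)[of i] kN[of i] kN[of "Suc i"] hk(1)[OF zT] by (auto simp: pullback_def)
    then have "(k (z i), k (z (Suc i))) \<in> ?J" using Cg_upper by blast
    then show ?case using Suc Con_equiv[OF J] unfolding equiv_def trans_def by (meson Suc_leD)
  qed
  then have "(k x, k y) \<in> ?J" using z by auto
  moreover have "(k x, k y) \<in> ?p \<alpha>"
    using kN[of 0] kN[of n] hk(1)[OF zT[of 0]] hk(1)[OF zT[of n]] z xy(1)
    by (auto simp: pullback_def)
  ultimately have k: "(k x, k y) \<in> Cg F N ((?p \<alpha> \<inter> ?p \<beta>) \<union> ?p \<gamma>)" using law by blast
  let ?K = "Cg F M ((\<alpha> \<inter> \<beta>) \<union> \<gamma>)"
  have K: "?K \<in> Con F M"
    using Cg_in_Con[OF M] Con_sub[OF \<alpha>] Con_sub[OF \<gamma>] by (meson Un_least inf.coboundedI1)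
  have "(\<alpha> \<inter> \<beta>) \<union> \<gamma> \<subseteq> ?K" by (rule Cg_upper)
  then have "(?p \<alpha> \<inter> ?p \<beta>) \<union> ?p \<gamma> \<subseteq> ?p ?K" unfolding pullback_def by blast
  then have "(k x, k y) \<in> ?p ?K" using Cg_least[OF pullback_in_Con[OF hom N K]] k by blast
  then show ?thesis
    using hk(1)[OF zT[of 0]] hk(1)[OF zT[of n]] z by (auto simp: pullback_def)
qed

theorem congruence_modular_con_modular:
  fixes F :: "('f \<times> nat) set" and M :: "('a, 'f) ualg"
  assumes "E \<subseteq> identities F" "congruence_modular F E" "M \<in> variety F E"
  shows "con_modular F M"
  unfolding con_modular_def
proof (intro ballI impI equalityI)
  fix \<alpha> \<beta> \<gamma> assume c: "\<alpha> \<in> Con F M" "\<beta> \<in> Con F M" "\<gamma> \<in> Con F M" "\<gamma> \<subseteq> \<alpha>"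
  show "\<alpha> \<inter> Cg F M (\<beta> \<union> \<gamma>) \<subseteq> Cg F M ((\<alpha> \<inter> \<beta>) \<union> \<gamma>)"
    using modular_step[OF assms c] by auto
  have M: "algebra F M" using assms(3) by (simp add: variety_def)
  have "Cg F M (\<beta> \<union> \<gamma>) \<in> Con F M"
    using c Con_sub by (intro Cg_in_Con[OF M]) blast
  then have "\<alpha> \<inter> Cg F M (\<beta> \<union> \<gamma>) \<in> Con F M" using c(1) Inter2_in_Con by blast
  then show "Cg F M ((\<alpha> \<inter> \<beta>) \<union> \<gamma>) \<subseteq> \<alpha> \<inter> Cg F M (\<beta> \<union> \<gamma>)"
    by (rule Cg_least) (use c(4) Cg_upper[of "\<beta> \<union> \<gamma>" F M] in blast)
qed

end

theory Submission
  imports Defs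
begin

text \<open>
  The heart of the matter is that, for a surjective homomorphism, a congruence of the image is prime
  if and only if its inverse image is prime. The non-trivial half needs two facts about the term
  condition in a congruence-modular class: it is preserved when \<open>\<delta>\<close> grows, and it is symmetric in
  \<open>\<alpha>\<close> and \<open>\<beta>\<close>. Both follow from the shifting lemma, applied in the algebra \<open>\<beta> \<le> M\<^sup>2\<close> to the
  congruence \<open>\<Delta>\<close> generated by the pairs of diagonal elements \<open>((a, a), (b, b))\<close> with
  \<open>(a, b) \<in> \<alpha>\<close>: the term condition says precisely that \<open>\<delta>\<close> is a union of \<open>\<Delta>\<close>-classes.

  Going Up for \<open>f\<^bsub>[\<theta>]\<^esub>\<close> is thereby Going Up for \<open>f\<close> restricted to primes \<open>\<phi>\<^sub>1\<close> of \<open>B\<close> with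
  \<open>\<theta> \<subseteq> f\<^sup>*(\<phi>\<^sub>1)\<close>. Every such inverse image contains \<open>Ker f\<close> and, by Zorn's lemma, a minimal prime.
\<close>

section \<open>Congruences and homomorphisms\<close>

lemma Con_refl: "\<theta> \<in> Con F M \<Longrightarrow> x \<in> carrier M \<Longrightarrow> (x, x) \<in> \<theta>"
  using Con_equiv by (fastforce simp: equiv_def refl_on_def)

lemma Con_sym: "\<theta> \<in> Con F M \<Longrightarrow> (x, y) \<in> \<theta> \<Longrightarrow> (y, x) \<in> \<theta>"
  using Con_equiv by (fastforce simp: equiv_def sym_def)

lemma Con_trans: "\<theta> \<in> Con F M \<Longrightarrow> (x, y) \<in> \<theta> \<Longrightarrow> (y, z) \<in> \<theta> \<Longrightarrow> (x, z) \<in> \<theta>"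
  using Con_equiv by (fastforce simp: equiv_def dest: transD)

lemma Con_carrier: "\<theta> \<in> Con F M \<Longrightarrow> (x, y) \<in> \<theta> \<Longrightarrow> x \<in> carrier M \<and> y \<in> carrier M"
  using Con_sub by fastforce

lemma Con_join:
  assumes "algebra F M" "\<alpha> \<in> Con F M" "\<beta> \<in> Con F M"
  shows "Cg F M (\<alpha> \<union> \<beta>) \<in> Con F M"
  using Cg_in_Con[OF assms(1)] Con_sub[OF assms(2)] Con_sub[OF assms(3)] by (meson Un_least)

lemma Id_in_Con:
  assumes "algebra F M"
  shows "Id_on (carrier M) \<in> Con F M"
  unfolding Con_def
proof (intro CollectI conjI allI impI)
  show "equiv (carrier M) (Id_on (carrier M))" by (auto simp: equiv_def refl_on_def sym_def trans_def)
  fix g xs ys assume a: "(g, length xs) \<in> F \<and> list_all2 (\<lambda>x y. (x, y) \<in> Id_on (carrier M)) xs ys"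
  then have "xs = ys" by (auto simp: list_all2_conv_all_nth intro!: nth_equalityI)
  moreover have "set xs \<subseteq> carrier M" using a list_all2_rel_sub[of "Id_on (carrier M)" xs ys] by blast
  ultimately show "(opr M g xs, opr M g ys) \<in> Id_on (carrier M)"
    using a assms by (auto simp: algebra_def)
qed

section \<open>Evaluation of terms: congruences, renaming and the variables that occur\<close>

lemma eval_Con:
  assumes "\<theta> \<in> Con F M" "\<And>v. (e v, e' v) \<in> \<theta>"
  shows "wf_trm F t \<Longrightarrow> (eval M e t, eval M e' t) \<in> \<theta>"
proof (induction t)
  case (App g ts)
  then have "list_all2 (\<lambda>x y. (x, y) \<in> \<theta>) (map (eval M e) ts) (map (eval M e') ts)"
    by (auto simp: list_all2_conv_all_nth)
  then show ?case using Con_opr[OF assms(1)] App by auto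
qed (use assms in auto)

lemma eval_map_trm: "eval M e (map_trm (\<lambda>x. x) r t) = eval M (e \<circ> r) t"
proof (induction t)
  case (App g ts)
  then have "map (\<lambda>t. eval M e (map_trm (\<lambda>x. x) r t)) ts = map (eval M (e \<circ> r)) ts"
    by (intro list.map_cong0)
  then show ?case by (simp only: trm.map eval.simps list.map_comp comp_def)
qed simp

lemma wf_map_trm: "wf_trm F (map_trm (\<lambda>x. x) r t) \<longleftrightarrow> wf_trm F t"
  by (induction t) auto

lemma eval_cong: "(\<And>v. v \<in> set2_trm t \<Longrightarrow> e v = e' v) \<Longrightarrow> eval M e t = eval M e' t"
proof (induction t)
  case (App g ts)
  then have "map (eval M e) ts = map (eval M e') ts" by auto
  then show ?case by (simp only: eval.simps)
qed auto

lemma finite_vars_trm: "finite (set2_trm t)"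
  by (induction t) auto

text \<open>Arguments linked by chains of \<open>R\<close>-steps can be exchanged one coordinate and
  one step at a time, since reflexivity of \<open>R\<close> lets the other coordinates stay put.
  This turns chains of term-condition matrices into a congruence.\<close>

lemma trancl_in_Con:
  assumes M: "algebra F M" and R: "refl_on (carrier M) R" "sym R" "R \<subseteq> carrier M \<times> carrier M"
    and comp: "\<And>g xs ys. (g, length xs) \<in> F \<Longrightarrow> list_all2 (\<lambda>x y. (x, y) \<in> R) xs ys
        \<Longrightarrow> (opr M g xs, opr M g ys) \<in> R"
  shows "R\<^sup>+ \<in> Con F M"
proof -
  let ?C = "carrier M"
  have sub: "R\<^sup>+ \<subseteq> ?C \<times> ?C" using R(3) by (rule trancl_subset_Sigma)
  have refl: "refl_on ?C (R\<^sup>+)" using R(1) by (auto simp: refl_on_def)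
  have eq: "equiv ?C (R\<^sup>+)"
    using sub refl sym_trancl[OF R(2)] trans_trancl by (rule equivI)
  have "(opr M g xs, opr M g ys) \<in> R\<^sup>+"
    if g: "(g, length xs) \<in> F" and l: "list_all2 (\<lambda>x y. (x, y) \<in> R\<^sup>+) xs ys" for g xs ys
  proof -
    have xs: "set xs \<subseteq> ?C" using list_all2_rel_sub[OF l sub] by simp
    \<comment> \<open>Coordinatewise chains, possibly of different lengths, become one chain of
      lists in which each step alters a single coordinate.\<close>
    have "(xs, ys) \<in> listrel (R\<^sup>*)"
      using l by (auto simp: listrel_iff_nth list_all2_conv_all_nth trancl_into_rtrancl)
    then have "(xs, ys) \<in> (listrel1 R)\<^sup>*" by (simp add: listrel_rtrancl_eq_rtrancl_listrel1)
    \<comment> \<open>The intermediate list is carried along as lying in the carrier and having the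
      right length, so that reflexivity and \<open>comp\<close> apply to the next step.\<close>
    then have "(opr M g xs, opr M g ys) \<in> R\<^sup>+ \<and> set ys \<subseteq> ?C \<and> length ys = length xs"
    proof (induction rule: rtrancl_induct)
      case base
      have "opr M g xs \<in> ?C" using M g xs unfolding algebra_def by blast
      then show ?case using xs refl by (auto simp: refl_on_def)
    next
      case (step ys zs)
      then obtain us y z vs where yz: "(y, z) \<in> R" "ys = us @ y # vs" "zs = us @ z # vs"
        unfolding listrel1_def by blast
      have "list_all2 (\<lambda>x y. (x, y) \<in> R) us us" "list_all2 (\<lambda>x y. (x, y) \<in> R) vs vs"
        using step.IH yz R(1) by (auto intro!: list.rel_refl_strong simp: refl_on_def)
      then have "list_all2 (\<lambda>x y. (x, y) \<in> R) ys zs" using yz by (auto intro: list_all2_appendI)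
      then have "(opr M g ys, opr M g zs) \<in> R" using comp[of g ys zs] g step.IH by simp
      moreover have "z \<in> ?C" using yz R(3) by blast
      ultimately show ?case using step.IH yz by (auto intro: trancl_into_trancl)
    qed
    then show ?thesis by simp
  qed
  then show ?thesis using eq unfolding Con_def by blast
qed


section \<open>A congruence as a subalgebra of the square\<close>

definition pair_alg :: "('a, 'f) ualg \<Rightarrow> ('a \<times> 'a) set \<Rightarrow> ('a \<times> 'a, 'f) ualg" where
  "pair_alg M \<beta> = \<lparr>carrier = \<beta>, opr = (\<lambda>g ps. (opr M g (map fst ps), opr M g (map snd ps)))\<rparr>"

lemma carrier_pair_alg [simp]: "carrier (pair_alg M \<beta>) = \<beta>"
  by (simp add: pair_alg_def)

lemma algebra_pair_alg:
  assumes "algebra F M" "\<beta> \<in> Con F M"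
  shows "algebra F (pair_alg M \<beta>)"
  unfolding algebra_def
proof (intro conjI allI impI)
  show "carrier (pair_alg M \<beta>) \<noteq> {}"
    using assms Con_refl[OF assms(2)] by (auto simp: algebra_def)
  fix g ps
  assume a: "(g, length ps) \<in> F \<and> set ps \<subseteq> carrier (pair_alg M \<beta>)"
  then have "\<forall>p \<in> set ps. (fst p, snd p) \<in> \<beta>" by auto
  then have "list_all2 (\<lambda>x y. (x, y) \<in> \<beta>) (map fst ps) (map snd ps)"
    by (simp add: list_all2_conv_all_nth)
  then show "opr (pair_alg M \<beta>) g ps \<in> carrier (pair_alg M \<beta>)"
    using a Con_opr[OF assms(2), of g "map fst ps"] by (simp add: pair_alg_def)
qed

lemma
  assumes "\<beta> \<in> Con F M"
  shows fst_hom: "is_hom F (pair_alg M \<beta>) M fst"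
    and snd_hom: "is_hom F (pair_alg M \<beta>) M snd"
    and diag_hom: "is_hom F M (pair_alg M \<beta>) (\<lambda>x. (x, x))"
  using Con_sub[OF assms] Con_refl[OF assms] by (auto simp: is_hom_def pair_alg_def o_def)

text \<open>The modular law is used for congruences of the algebra \<beta> and not of
  \<open>M\<close>, so \<beta> has to belong to the class. Both projections respect evaluation and a
  pair is determined by its coordinates, hence the identities are inherited.\<close>

lemma pair_alg_variety:
  assumes "E \<subseteq> identities F" "M \<in> variety F E" "\<beta> \<in> Con F M"
  shows "pair_alg M \<beta> \<in> variety F E"
proof -
  let ?N = "pair_alg M \<beta>"
  have M: "algebra F M" using assms(2) by (simp add: variety_def)
  note N = algebra_pair_alg[OF M assms(3)]
  have "eval ?N e s = eval ?N e t" if st: "(s, t) \<in> E" and e: "range e \<subseteq> carrier ?N" for s t e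
  proof -
    have wf: "wf_trm F s" "wf_trm F t" using st assms(1) by (auto simp: identities_def)
    have "h (eval ?N e s) = h (eval ?N e t)" if h: "is_hom F ?N M h" for h
    proof -
      have "range (h \<circ> e) \<subseteq> carrier M" using h e by (auto simp: is_hom_def)
      then have "eval M (h \<circ> e) s = eval M (h \<circ> e) t" using assms(2) st unfolding variety_def by blast
      then show ?thesis using eval_hom[OF h N e] wf by simp
    qed
    then show ?thesis using fst_hom[OF assms(3)] snd_hom[OF assms(3)] by (simp add: prod_eq_iff)
  qed
  then show ?thesis using N unfolding variety_def by blast
qed

text \<open>An element \<open>((x, y), (z, w))\<close> is best read as a 2 by 2 matrix with rows
  \<open>(x, y)\<close> and \<open>(z, w)\<close>: its rows lie in \<beta> and its columns in
  \<alpha>.\<close>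

definition Delta :: "('f \<times> nat) set \<Rightarrow> ('a, 'f) ualg \<Rightarrow> ('a \<times> 'a) set \<Rightarrow> ('a \<times> 'a) set
    \<Rightarrow> (('a \<times> 'a) \<times> ('a \<times> 'a)) set" where
  "Delta F M \<alpha> \<beta> = Cg F (pair_alg M \<beta>) ((\<lambda>(a, b). ((a, a), (b, b))) ` \<alpha>)"

lemma Delta_in_Con:
  assumes "algebra F M" "\<alpha> \<in> Con F M" "\<beta> \<in> Con F M"
  shows "Delta F M \<alpha> \<beta> \<in> Con F (pair_alg M \<beta>)"
  unfolding Delta_def
  using Con_carrier[OF assms(2)] Con_refl[OF assms(3)]
  by (intro Cg_in_Con[OF algebra_pair_alg[OF assms(1,3)]]) auto

lemma Delta_diag: "(a, b) \<in> \<alpha> \<Longrightarrow> ((a, a), (b, b)) \<in> Delta F M \<alpha> \<beta>"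
  unfolding Delta_def using Cg_upper by fastforce

lemma Delta_least:
  assumes "\<Theta> \<in> Con F (pair_alg M \<beta>)" "\<And>a b. (a, b) \<in> \<alpha> \<Longrightarrow> ((a, a), (b, b)) \<in> \<Theta>"
  shows "Delta F M \<alpha> \<beta> \<subseteq> \<Theta>"
  unfolding Delta_def by (rule Cg_least) (use assms in auto)

text \<open>The inverse image of \<alpha> under the first projection is a congruence containing the
  generators. Its use is to compare a matrix with the diagonal one built from its first
  column.\<close>

lemma Delta_fst:
  assumes "algebra F M" "\<alpha> \<in> Con F M" "\<beta> \<in> Con F M" "((x, y), (z, w)) \<in> Delta F M \<alpha> \<beta>"
  shows "(x, z) \<in> \<alpha>"
proof -
  have "Delta F M \<alpha> \<beta> \<subseteq> pullback (pair_alg M \<beta>) fst \<alpha>"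
    using Con_carrier[OF assms(2)] Con_refl[OF assms(3)]
    by (intro Delta_least pullback_in_Con[OF fst_hom[OF assms(3)] algebra_pair_alg[OF assms(1,3)] assms(2)])
      (auto simp: pullback_def)
  then show ?thesis using assms(4) by (auto simp: pullback_def)
qed


section \<open>The term condition\<close>

text \<open>A term has finitely many variables, so these may be renamed to natural numbers.\<close>

lemma term_condition_vars:
  fixes t :: "('f, 'v + 'w) trm"
  assumes tc: "term_condition F M \<alpha> \<beta> \<delta>" and wf: "wf_trm F t"
    and ab: "\<And>i. (a i, b i) \<in> \<alpha>" and cd: "\<And>j. (c j, d j) \<in> \<beta>"
    and t: "(eval M (case_sum a c) t, eval M (case_sum a d) t) \<in> \<delta>"
  shows "(eval M (case_sum b c) t, eval M (case_sum b d) t) \<in> \<delta>"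
proof -
  let ?V = "{v. Inl v \<in> set2_trm t}" and ?W = "{w. Inr w \<in> set2_trm t}"
  have V: "finite ?V" and W: "finite ?W"
    using finite_vimageI[OF finite_vars_trm[of t], of Inl] finite_vimageI[OF finite_vars_trm[of t], of Inr]
    by (simp_all add: vimage_def)
  obtain r :: "'v \<Rightarrow> nat" where r: "inj_on r ?V" using finite_imp_inj_to_nat_seg[OF V] by blast
  obtain s :: "'w \<Rightarrow> nat" where s: "inj_on s ?W" using finite_imp_inj_to_nat_seg[OF W] by blast
  let ?r = "inv_into ?V r :: nat \<Rightarrow> 'v" and ?s = "inv_into ?W s :: nat \<Rightarrow> 'w"
  let ?t = "map_trm (\<lambda>x. x) (map_sum r s) t"
  \<comment> \<open>On numbers that name no variable of \<open>t\<close>, the maps \<open>?r\<close>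
    and \<open>?s\<close> take arbitrary values. This is harmless: evaluation only sees the
    variables that occur, and \<open>ab\<close> and \<open>cd\<close> hold for all indices.\<close>
  have e: "eval M (case_sum (a \<circ> ?r) (c \<circ> ?s)) ?t = eval M (case_sum a c) t" for a c
    unfolding eval_map_trm
    by (rule eval_cong) (auto simp: inv_into_f_f[OF r] inv_into_f_f[OF s] split: sum.split)
  have "(eval M (case_sum (b \<circ> ?r) (c \<circ> ?s)) ?t, eval M (case_sum (b \<circ> ?r) (d \<circ> ?s)) ?t) \<in> \<delta>"
    using tc[unfolded term_condition_def, rule_format, of ?t "a \<circ> ?r" "b \<circ> ?r" "c \<circ> ?s" "d \<circ> ?s"]
      wf ab cd t by (simp add: wf_map_trm e)
  then show ?thesis by (simp add: e)
qed

text \<open>Left to right, the matrices of term values form a reflexive, symmetric, compatible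
  relation containing the generators, so its transitive closure contains \<open>Delta\<close>; each
  matrix preserves \<delta> by the term condition, and so do chains. Conversely, a term evaluated
  under \<open>Delta\<close>-related assignments has \<open>Delta\<close>-related values.\<close>

lemma term_condition_iff:
  fixes M :: "('a, 'f) ualg"
  assumes M: "algebra F M" and \<alpha>: "\<alpha> \<in> Con F M" and \<beta>: "\<beta> \<in> Con F M"
  shows "term_condition F M \<alpha> \<beta> \<delta> \<longleftrightarrow> (\<forall>(p, q) \<in> Delta F M \<alpha> \<beta>. p \<in> \<delta> \<longrightarrow> q \<in> \<delta>)"
proof
  let ?N = "pair_alg M \<beta>"
  note N = algebra_pair_alg[OF M \<beta>]
  assume tc: "term_condition F M \<alpha> \<beta> \<delta>"
  obtain z where z: "z \<in> carrier M" using M by (auto simp: algebra_def)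
  define k where "k \<gamma> p = (if p \<in> \<gamma> then p else (z, z))" for \<gamma> :: "('a \<times> 'a) set" and p
  have k: "k \<gamma> p \<in> \<gamma>" if "\<gamma> \<in> Con F M" for \<gamma> p using Con_refl[OF that z] by (simp add: k_def)
  define e e' :: "('a \<times> 'a) + ('a \<times> 'a) \<Rightarrow> 'a \<times> 'a" where
    "e = case_sum (\<lambda>p. (fst (k \<alpha> p), fst (k \<alpha> p))) (k \<beta>)" and
    "e' = case_sum (\<lambda>p. (snd (k \<alpha> p), snd (k \<alpha> p))) (k \<beta>)"
  have C: "fst (k \<alpha> p) \<in> carrier M" "snd (k \<alpha> p) \<in> carrier M" for p
    using Con_carrier[OF \<alpha>, of "fst (k \<alpha> p)" "snd (k \<alpha> p)"] k[OF \<alpha>] by auto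
  have e: "range e \<subseteq> carrier ?N" "range e' \<subseteq> carrier ?N"
    using C Con_refl[OF \<beta>] k[OF \<beta>] by (auto simp: e_def e'_def split: sum.splits)
  \<comment> \<open>Every element of \<open>\<alpha>\<close> and \<open>\<beta>\<close> is the value of a variable of its own (\<open>k\<close> sends the other
    variables to a dummy), so that \<open>R\<close> is the set of all matrices of the term condition.\<close>
  define R where "R = {(eval ?N e t, eval ?N e' t) | t. wf_trm F t}"
  have R_sub: "R \<subseteq> \<beta> \<times> \<beta>" using eval_closed[OF N e(1)] eval_closed[OF N e(2)] by (auto simp: R_def)
  have R_refl: "refl_on \<beta> R"
    unfolding refl_on_def
  proof
    fix p assume "p \<in> \<beta>"
    then show "(p, p) \<in> R"
      unfolding R_def by (intro CollectI exI[of _ "Var (Inr p)"]) (simp add: e_def e'_def k_def)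
  qed
  \<comment> \<open>Swapping the two entries of each variable indexed by \<alpha> exchanges the rows
    of a matrix, which makes \<open>R\<close> symmetric.\<close>
  define \<sigma> :: "('a \<times> 'a) + ('a \<times> 'a) \<Rightarrow> ('a \<times> 'a) + ('a \<times> 'a)" where "\<sigma> = map_sum prod.swap id"
  have "k \<alpha> (prod.swap p) = prod.swap (k \<alpha> p)" for p
  proof (cases p)
    case (Pair a b)
    have "(b, a) \<in> \<alpha> \<longleftrightarrow> (a, b) \<in> \<alpha>" using Con_sym[OF \<alpha>] by blast
    then show ?thesis by (simp add: k_def Pair)
  qed
  then have \<sigma>: "e \<circ> \<sigma> = e'" "e' \<circ> \<sigma> = e"
    by (auto simp: \<sigma>_def e_def e'_def fun_eq_iff split: sum.split)
  have R_sym: "sym R"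
  proof (rule symI)
    fix p q assume "(p, q) \<in> R"
    then obtain t where "wf_trm F t" "p = eval ?N e t" "q = eval ?N e' t" by (auto simp: R_def)
    then have "wf_trm F (map_trm (\<lambda>x. x) \<sigma> t)" "q = eval ?N e (map_trm (\<lambda>x. x) \<sigma> t)" "p = eval ?N e' (map_trm (\<lambda>x. x) \<sigma> t)"
      by (simp_all add: wf_map_trm eval_map_trm \<sigma>)
    then show "(q, p) \<in> R" unfolding R_def by blast
  qed
  have R_comp: "(opr ?N g ps, opr ?N g qs) \<in> R"
    if "(g, length ps) \<in> F" "list_all2 (\<lambda>p q. (p, q) \<in> R) ps qs" for g ps qs
  proof -
    have "\<forall>i < length ps. \<exists>t. wf_trm F t \<and> ps ! i = eval ?N e t \<and> qs ! i = eval ?N e' t"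
      using that(2) by (auto simp: R_def list_all2_conv_all_nth)
    then obtain T where T: "\<And>i. i < length ps \<Longrightarrow>
        wf_trm F (T i) \<and> ps ! i = eval ?N e (T i) \<and> qs ! i = eval ?N e' (T i)"
      by metis
    let ?t = "App g (map T [0..<length ps])"
    have "map (eval ?N e) (map T [0..<length ps]) = ps" "map (eval ?N e') (map T [0..<length ps]) = qs"
      using T list_all2_lengthD[OF that(2)] by (auto intro!: nth_equalityI)
    then have "opr ?N g ps = eval ?N e ?t" "opr ?N g qs = eval ?N e' ?t" by (simp_all only: eval.simps)
    moreover have "wf_trm F ?t" using that(1) T by auto
    ultimately show ?thesis unfolding R_def by blast
  qed
  have R_diag: "((a, a), (b, b)) \<in> R" if "(a, b) \<in> \<alpha>" for a b
    unfolding R_def using that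
    by (intro CollectI exI[of _ "Var (Inl (a, b))"]) (simp add: e_def e'_def k_def)
  have "R\<^sup>+ \<in> Con F ?N"
    using trancl_in_Con[OF N _ R_sym _ R_comp] R_refl R_sub by simp
  then have sub: "Delta F M \<alpha> \<beta> \<subseteq> R\<^sup>+" by (rule Delta_least) (use R_diag in blast)
  have R: "q \<in> \<delta>" if pq: "(p, q) \<in> R" "p \<in> \<delta>" for p q
  proof -
    obtain t where t: "wf_trm F t" "p = eval ?N e t" "q = eval ?N e' t" using pq(1) by (auto simp: R_def)
    \<comment> \<open>The projections are homomorphisms, so evaluation in \<open>?N\<close> is
      coordinatewise and \<open>(p, q)\<close> is literally an instance of the term
      condition.\<close>
    have ev: "eval ?N d t = (eval M (fst \<circ> d) t, eval M (snd \<circ> d) t)" if "range d \<subseteq> carrier ?N" for d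
      using eval_hom[OF fst_hom[OF \<beta>] N that t(1)] eval_hom[OF snd_hom[OF \<beta>] N that t(1)]
      by (simp add: prod_eq_iff)
    have "fst \<circ> e = case_sum (fst \<circ> k \<alpha>) (fst \<circ> k \<beta>)" "snd \<circ> e = case_sum (fst \<circ> k \<alpha>) (snd \<circ> k \<beta>)"
      "fst \<circ> e' = case_sum (snd \<circ> k \<alpha>) (fst \<circ> k \<beta>)" "snd \<circ> e' = case_sum (snd \<circ> k \<alpha>) (snd \<circ> k \<beta>)"
      by (auto simp: e_def e'_def fun_eq_iff split: sum.split)
    then show ?thesis
      using term_condition_vars[OF tc t(1), of "fst \<circ> k \<alpha>" "snd \<circ> k \<alpha>" "fst \<circ> k \<beta>" "snd \<circ> k \<beta>"]
        pq(2) t(2,3) ev e k[OF \<alpha>] k[OF \<beta>] by simp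
  qed
  have "q \<in> \<delta>" if "(p, q) \<in> R\<^sup>+" "p \<in> \<delta>" for p q
    using that by (induction rule: trancl_induct) (auto intro: R)
  then show "\<forall>(p, q) \<in> Delta F M \<alpha> \<beta>. p \<in> \<delta> \<longrightarrow> q \<in> \<delta>" using sub by auto
next
  let ?N = "pair_alg M \<beta>"
  note N = algebra_pair_alg[OF M \<beta>]
  assume D: "\<forall>(p, q) \<in> Delta F M \<alpha> \<beta>. p \<in> \<delta> \<longrightarrow> q \<in> \<delta>"
  show "term_condition F M \<alpha> \<beta> \<delta>"
    unfolding term_condition_def
  proof (intro allI impI, elim conjE)
    fix t :: "('f, nat + nat) trm" and a b c d :: "nat \<Rightarrow> 'a"
    assume t: "wf_trm F t" and ab: "\<forall>i. (a i, b i) \<in> \<alpha>" and cd: "\<forall>j. (c j, d j) \<in> \<beta>"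
      and \<delta>: "(eval M (case_sum a c) t, eval M (case_sum a d) t) \<in> \<delta>"
    \<comment> \<open>The first block of variables takes diagonal values, so passing from
      \<open>a\<close> to \<open>b\<close> there uses generators of \<open>Delta\<close>; the second
      block stays fixed and only needs reflexivity.\<close>
    define e where "e a = case_sum (\<lambda>i. (a i, a i)) (\<lambda>j. (c j, d j))" for a :: "nat \<Rightarrow> 'a"
    have e: "(e a v, e b v) \<in> Delta F M \<alpha> \<beta>" for v
      using ab cd Con_refl[OF Delta_in_Con[OF M \<alpha> \<beta>]]
      by (auto simp: e_def intro: Delta_diag split: sum.split)
    have De: "(eval ?N (e a) t, eval ?N (e b) t) \<in> Delta F M \<alpha> \<beta>"
      by (rule eval_Con[OF Delta_in_Con[OF M \<alpha> \<beta>] e t])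
    have r: "range (e a) \<subseteq> carrier ?N" "range (e b) \<subseteq> carrier ?N"
      using Con_carrier[OF Delta_in_Con[OF M \<alpha> \<beta>]] e by blast+
    have "fst \<circ> e x = case_sum x c" "snd \<circ> e x = case_sum x d" for x
      by (auto simp: e_def fun_eq_iff split: sum.split)
    then have "eval ?N (e x) t = (eval M (case_sum x c) t, eval M (case_sum x d) t)"
      if "range (e x) \<subseteq> carrier ?N" for x
      using eval_hom[OF fst_hom[OF \<beta>] N that t] eval_hom[OF snd_hom[OF \<beta>] N that t]
      by (simp add: prod_eq_iff)
    then show "(eval M (case_sum b c) t, eval M (case_sum b d) t) \<in> \<delta>" using D De r \<delta> by auto
  qed
qed

section \<open>Modularity and the term condition\<close>

text \<open>Gumm's shifting lemma. The path from \<open>r\<close> over \<open>p\<close> and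
  \<open>q\<close> to \<open>s\<close> puts \<open>(r, s)\<close> into the join of \<alpha> and
  \<open>\<beta> \<inter> \<gamma>\<close>; by the modular law, the meet of this join with \<beta>
  is the join of \<open>\<beta> \<inter> \<alpha>\<close> and
  \<open>\<beta> \<inter> \<gamma>\<close>, both of which lie in \<gamma>.\<close>

lemma shifting:
  assumes "con_modular F N" "\<alpha> \<in> Con F N" "\<beta> \<in> Con F N" "\<gamma> \<in> Con F N" "\<alpha> \<inter> \<beta> \<subseteq> \<gamma>"
    and "algebra F N" "(p, r) \<in> \<alpha>" "(q, s) \<in> \<alpha>" "(p, q) \<in> \<beta>" "(r, s) \<in> \<beta>" "(p, q) \<in> \<gamma>"
  shows "(r, s) \<in> \<gamma>"
proof -
  have \<beta>\<gamma>: "\<beta> \<inter> \<gamma> \<in> Con F N" using assms(3,4) by (rule Inter2_in_Con)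
  let ?J = "Cg F N (\<alpha> \<union> (\<beta> \<inter> \<gamma>))"
  have J: "?J \<in> Con F N" by (rule Con_join[OF assms(6,2) \<beta>\<gamma>])
  have sub: "\<alpha> \<union> (\<beta> \<inter> \<gamma>) \<subseteq> ?J" by (rule Cg_upper)
  have "(r, p) \<in> ?J" "(p, q) \<in> ?J" "(q, s) \<in> ?J"
    using Con_sym[OF assms(2,7)] sub assms by blast+
  then have "(r, s) \<in> ?J" using Con_trans[OF J] by blast
  moreover have "\<beta> \<inter> ?J = Cg F N ((\<beta> \<inter> \<alpha>) \<union> (\<beta> \<inter> \<gamma>))"
    using assms(1-3) \<beta>\<gamma> unfolding con_modular_def by blast
  moreover have "Cg F N ((\<beta> \<inter> \<alpha>) \<union> (\<beta> \<inter> \<gamma>)) \<subseteq> \<gamma>"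
    by (rule Cg_least) (use assms(4,5) in auto)
  ultimately show ?thesis using assms(10) by blast
qed

text \<open>Both claims rest on \<open>vert\<close>, which treats matrices with constant first
  column. A general matrix with rows \<open>(x, y)\<close> and \<open>(z, w)\<close> is compared
  with the diagonal one with rows \<open>(x, x)\<close> and \<open>(z, z)\<close>, supplied by
  \<open>base\<close>, and the shifting lemma carries the relation across.\<close>

lemma
  fixes F :: "('f \<times> nat) set" and M :: "('a, 'f) ualg"
  assumes M: "algebra F M" and mod: "con_modular F (pair_alg M \<beta>)"
    and \<alpha>: "\<alpha> \<in> Con F M" and \<beta>: "\<beta> \<in> Con F M" and \<delta>: "\<delta> \<in> Con F M"
    and tc: "term_condition F M \<alpha> \<beta> \<delta>"
  shows term_condition_mono: "\<epsilon> \<in> Con F M \<Longrightarrow> \<delta> \<subseteq> \<epsilon> \<Longrightarrow> term_condition F M \<alpha> \<beta> \<epsilon>"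
    and term_condition_sym: "term_condition F M \<beta> \<alpha> \<delta>"
proof -
  let ?N = "pair_alg M \<beta>" and ?D = "Delta F M \<alpha> \<beta>"
  note N = algebra_pair_alg[OF M \<beta>] and D = Delta_in_Con[OF M \<alpha> \<beta>]
  define \<eta> where "\<eta> h \<gamma> = pullback ?N h \<gamma>" for h :: "'a \<times> 'a \<Rightarrow> 'a" and \<gamma>
  note Id = Id_in_Con[OF M]
  have \<eta>: "\<eta> fst \<gamma> \<in> Con F ?N" "\<eta> snd \<gamma> \<in> Con F ?N" if "\<gamma> \<in> Con F M" for \<gamma>
    unfolding \<eta>_def using that by (rule pullback_in_Con[OF fst_hom[OF \<beta>] N] pullback_in_Con[OF snd_hom[OF \<beta>] N])+
  \<comment> \<open>The kernels of the two projections: equality of first and of second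
    coordinates.\<close>
  let ?\<eta>0 = "\<eta> fst (Id_on (carrier M))" and ?\<eta>1 = "\<eta> snd (Id_on (carrier M))"
  have \<eta>0: "((x, y), (x', y')) \<in> ?\<eta>0 \<longleftrightarrow> (x, y) \<in> \<beta> \<and> (x', y') \<in> \<beta> \<and> x = x'" for x y x' y'
    using Con_sub[OF \<beta>] by (auto simp: \<eta>_def pullback_def)
  have \<eta>1: "((x, y), (x', y')) \<in> ?\<eta>1 \<longleftrightarrow> (x, y) \<in> \<beta> \<and> (x', y') \<in> \<beta> \<and> y = y'" for x y x' y'
    using Con_sub[OF \<beta>] by (auto simp: \<eta>_def pullback_def)
  have snd: "((x, y), (x', y')) \<in> \<eta> snd \<gamma> \<longleftrightarrow> (x, y) \<in> \<beta> \<and> (x', y') \<in> \<beta> \<and> (y, y') \<in> \<gamma>" for x y x' y' \<gamma>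
    by (auto simp: \<eta>_def pullback_def)
  have D\<beta>: "(x, y) \<in> \<beta>" "(z, w) \<in> \<beta>" if "((x, y), (z, w)) \<in> ?D" for x y z w
    using Con_carrier[OF D that] by auto
  have diag: "(x, x) \<in> \<beta>" if "(x, y) \<in> \<beta>" for x y
    using Con_refl[OF \<beta>] Con_carrier[OF \<beta> that] by blast
  \<comment> \<open>The shift of \<open>(u, v) \<Delta> (u, v')\<close> along second coordinates to \<open>(v, v) \<Delta> (v, v')\<close>.\<close>
  have vert: "(v, v') \<in> \<delta>" if uv: "((u, v), (u, v')) \<in> ?D" for u v v'
  proof -
    have vv: "(v, v') \<in> \<beta>" "(v, v) \<in> \<beta>"
      using D\<beta>[OF uv] Con_sym[OF \<beta>] Con_trans[OF \<beta>] by blast+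
    have "((v, v), (v, v')) \<in> ?D"
    proof (rule shifting[OF mod \<eta>(2)[OF Id] \<eta>(1)[OF Id] D _ N])
      show "?\<eta>1 \<inter> ?\<eta>0 \<subseteq> ?D"
        using Con_refl[OF D] by (auto simp: \<eta>0 \<eta>1)
    qed (use uv D\<beta>[OF uv] vv in \<open>auto simp: \<eta>0 \<eta>1\<close>)
    moreover have "(v, v) \<in> \<delta>" using Con_refl[OF \<delta>] Con_carrier[OF \<beta> vv(1)] by blast
    ultimately show ?thesis using tc unfolding term_condition_iff[OF M \<alpha> \<beta>] by blast
  qed
  have base: "((x, x), (z, z)) \<in> ?D" if "((x, y), (z, w)) \<in> ?D" for x y z w
    using Delta_fst[OF M \<alpha> \<beta> that] by (rule Delta_diag)
  show "term_condition F M \<alpha> \<beta> \<epsilon>" if \<epsilon>: "\<epsilon> \<in> Con F M" "\<delta> \<subseteq> \<epsilon>"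
    unfolding term_condition_iff[OF M \<alpha> \<beta>]
  proof (clarify)
    fix x y z w assume xyzw: "((x, y), (z, w)) \<in> ?D" and xy: "(x, y) \<in> \<epsilon>"
    \<comment> \<open>The parallelogram has \<open>?D\<close>-sides from \<open>(x, x)\<close> to
      \<open>(z, z)\<close> and from \<open>(x, y)\<close> to \<open>(z, w)\<close>; the relation
      \<epsilon> between second coordinates moves from the \<open>x\<close>-side to the
      \<open>z\<close>-side.\<close>
    have "((z, z), (z, w)) \<in> \<eta> snd \<epsilon>"
    proof (rule shifting[OF mod D \<eta>(1)[OF Id] \<eta>(2)[OF \<epsilon>(1)] _ N])
      show "?D \<inter> ?\<eta>0 \<subseteq> \<eta> snd \<epsilon>"
        using subsetD[OF \<epsilon>(2) vert] by (auto simp: \<eta>0 snd)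
      show "((x, x), (z, z)) \<in> ?D" using xyzw by (rule base)
    qed (use xyzw xy D\<beta>[OF xyzw] diag in \<open>auto simp: \<eta>0 snd\<close>)
    then show "(z, w) \<in> \<epsilon>" by (simp add: snd)
  qed
  show "term_condition F M \<beta> \<alpha> \<delta>"
    unfolding term_condition_def
  proof (intro allI impI, elim conjE)
    fix t :: "('f, nat + nat) trm" and a b c d :: "nat \<Rightarrow> 'a"
    assume t: "wf_trm F t" and ab: "\<forall>i. (a i, b i) \<in> \<beta>" and cd: "\<forall>j. (c j, d j) \<in> \<alpha>"
      and eq: "(eval M (case_sum a c) t, eval M (case_sum a d) t) \<in> \<delta>"
    \<comment> \<open>Now the first block carries the pairs from \<beta> and the second block the
      diagonal, so the matrix of the swapped condition appears in \<open>?D\<close>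
      transposed.\<close>
    define e where "e c = case_sum (\<lambda>i. (a i, b i)) (\<lambda>j. (c j, c j))" for c :: "nat \<Rightarrow> 'a"
    have e: "(e c v, e d v) \<in> ?D" for v
      using ab cd Con_refl[OF D] by (auto simp: e_def intro: Delta_diag split: sum.split)
    have r: "range (e c) \<subseteq> carrier ?N" "range (e d) \<subseteq> carrier ?N"
      using Con_carrier[OF D] e by blast+
    have "fst \<circ> e x = case_sum a x" "snd \<circ> e x = case_sum b x" for x
      by (auto simp: e_def fun_eq_iff split: sum.split)
    then have ev: "eval ?N (e x) t = (eval M (case_sum a x) t, eval M (case_sum b x) t)"
      if "range (e x) \<subseteq> carrier ?N" for x
      using eval_hom[OF fst_hom[OF \<beta>] N that t] eval_hom[OF snd_hom[OF \<beta>] N that t]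
      by (simp add: prod_eq_iff)
    let ?x = "eval M (case_sum a c) t" and ?y = "eval M (case_sum b c) t"
      and ?z = "eval M (case_sum a d) t" and ?w = "eval M (case_sum b d) t"
    have "(eval ?N (e c) t, eval ?N (e d) t) \<in> ?D" by (rule eval_Con[OF D e t])
    then have De: "((?x, ?y), (?z, ?w)) \<in> ?D" unfolding ev[OF r(1)] ev[OF r(2)] .
    \<comment> \<open>The same parallelogram with the roles of \<open>?\<eta>0\<close> and
      \<open>?D\<close> exchanged: the relation \<delta> moves from the first column to the
      second.\<close>
    have "((?x, ?y), (?z, ?w)) \<in> \<eta> snd \<delta>"
    proof (rule shifting[OF mod \<eta>(1)[OF Id] D \<eta>(2)[OF \<delta>] _ N])
      show "?\<eta>0 \<inter> ?D \<subseteq> \<eta> snd \<delta>" using vert by (auto simp: \<eta>0 snd)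
      show "((?x, ?x), (?z, ?z)) \<in> ?D" using De by (rule base)
    qed (use De eq D\<beta>[OF De] diag in \<open>auto simp: \<eta>0 snd\<close>)
    then show "(?y, ?w) \<in> \<delta>" by (simp add: snd)
  qed
qed

text \<open>Both columns of every matrix lie in \<delta>, because those of the generators do; if the
  first row lies in \<delta> too, transitivity around the matrix gives the second.\<close>

lemma term_condition_trivial:
  assumes "algebra F M" "\<theta> \<in> Con F M" "\<beta> \<in> Con F M" "\<delta> \<in> Con F M" "\<theta> \<subseteq> \<delta>"
  shows "term_condition F M \<theta> \<beta> \<delta>"
proof -
  have "Delta F M \<theta> \<beta> \<subseteq> pullback (pair_alg M \<beta>) fst \<delta> \<inter> pullback (pair_alg M \<beta>) snd \<delta>"
    using Con_carrier[OF assms(2)] Con_refl[OF assms(3)] assms(5)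
      pullback_in_Con[OF fst_hom[OF assms(3)] algebra_pair_alg[OF assms(1,3)] assms(4)]
      pullback_in_Con[OF snd_hom[OF assms(3)] algebra_pair_alg[OF assms(1,3)] assms(4)]
    by (intro Delta_least Inter2_in_Con) (auto simp: pullback_def)
  then have D: "(x, z) \<in> \<delta>" "(y, w) \<in> \<delta>" if "((x, y), (z, w)) \<in> Delta F M \<theta> \<beta>" for x y z w
    using that by (auto simp: pullback_def)
  show ?thesis
    unfolding term_condition_iff[OF assms(1-3)]
    using Con_trans[OF assms(4) Con_trans[OF assms(4) Con_sym[OF assms(4) D(1)]] D(2)] by auto
qed

text \<open>The join of the two \<open>Delta\<close> congruences, pulled back along the diagonal,
  contains \<alpha> and \<alpha>' and hence their join. So \<open>Delta\<close> of the join consists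
  of chains of steps from the two given ones, each of which preserves \<delta>.\<close>

lemma term_condition_join:
  assumes M: "algebra F M" and \<alpha>: "\<alpha> \<in> Con F M" and \<alpha>': "\<alpha>' \<in> Con F M" and \<beta>: "\<beta> \<in> Con F M"
    and tc: "term_condition F M \<alpha> \<beta> \<delta>" "term_condition F M \<alpha>' \<beta> \<delta>"
  shows "term_condition F M (Cg F M (\<alpha> \<union> \<alpha>')) \<beta> \<delta>"
proof -
  let ?J = "Cg F M (\<alpha> \<union> \<alpha>')" and ?N = "pair_alg M \<beta>"
  let ?D = "Delta F M \<alpha> \<beta>" and ?D' = "Delta F M \<alpha>' \<beta>"
  note N = algebra_pair_alg[OF M \<beta>]
  note D = Delta_in_Con[OF M \<alpha> \<beta>] and D' = Delta_in_Con[OF M \<alpha>' \<beta>]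
  let ?\<Theta> = "Cg F ?N (?D \<union> ?D')"
  have \<Theta>: "?\<Theta> \<in> Con F ?N" by (rule Con_join[OF N D D'])
  have sub: "?D \<union> ?D' \<subseteq> ?\<Theta>" by (rule Cg_upper)
  have "\<alpha> \<union> \<alpha>' \<subseteq> pullback M (\<lambda>x. (x, x)) ?\<Theta>"
    using Delta_diag[of _ _ \<alpha> F M \<beta>] Delta_diag[of _ _ \<alpha>' F M \<beta>] sub Con_carrier[OF \<alpha>] Con_carrier[OF \<alpha>']
    unfolding pullback_def by blast
  then have "?J \<subseteq> pullback M (\<lambda>x. (x, x)) ?\<Theta>"
    by (rule Cg_least[OF pullback_in_Con[OF diag_hom[OF \<beta>] M \<Theta>]])
  then have "Delta F M ?J \<beta> \<subseteq> ?\<Theta>" by (intro Delta_least[OF \<Theta>]) (auto simp: pullback_def)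
  also have "\<dots> \<subseteq> (?D \<union> ?D')\<^sup>*" by (rule Cg_Un_subset_rtrancl[OF N D D'])
  finally have sub: "Delta F M ?J \<beta> \<subseteq> (?D \<union> ?D')\<^sup>*" .
  have "q \<in> \<delta>" if "(p, q) \<in> (?D \<union> ?D')\<^sup>*" "p \<in> \<delta>" for p q
    using that
  proof (induction rule: rtrancl_induct)
    case (step q r)
    then show ?case
      using tc unfolding term_condition_iff[OF M \<alpha> \<beta>] term_condition_iff[OF M \<alpha>' \<beta>] by blast
  qed
  then show ?thesis
    unfolding term_condition_iff[OF M Con_join[OF M \<alpha> \<alpha>'] \<beta>] using sub by blast
qed

section \<open>Surjective homomorphisms\<close>

lemma pullback_mono: "\<psi> \<subseteq> \<psi>' \<Longrightarrow> pullback A f \<psi> \<subseteq> pullback A f \<psi>'"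
  by (auto simp: pullback_def)

text \<open>The instances below are the canonical projections onto quotient algebras.\<close>

locale surjective_hom =
  fixes F :: "('f \<times> nat) set" and M :: "('a, 'f) ualg" and Q :: "('b, 'f) ualg" and h :: "'a \<Rightarrow> 'b"
  assumes M: "algebra F M" and hom: "is_hom F M Q h" and surj: "h ` carrier M = carrier Q"
begin

section \<open>Inverse images of congruences and of the term condition along a surjection\<close>

lemma hom_opr: "(g, length xs) \<in> F \<Longrightarrow> set xs \<subseteq> carrier M \<Longrightarrow> h (opr M g xs) = opr Q g (map h xs)"
  using hom by (auto simp: is_hom_def)

lemma algebra_Q: "algebra F Q"
  unfolding algebra_def
proof (intro conjI allI impI)
  show "carrier Q \<noteq> {}" using M surj by (auto simp: algebra_def)
  fix g ys assume a: "(g, length ys) \<in> F \<and> set ys \<subseteq> carrier Q"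
  then have "ys \<in> lists (h ` carrier M)" using surj by blast
  then obtain xs where xs: "ys = map h xs" "set xs \<subseteq> carrier M" unfolding lists_image by auto
  then have "opr Q g ys = h (opr M g xs)" using a hom_opr by simp
  moreover have "opr M g xs \<in> carrier M" using M a xs by (simp add: algebra_def)
  ultimately show "opr Q g ys \<in> carrier Q" using surj by blast
qed

lemma pullback_Con: "\<psi> \<in> Con F Q \<Longrightarrow> pullback M h \<psi> \<in> Con F M"
  by (rule pullback_in_Con[OF hom M])

lemma pullback_subset_iff:
  assumes "\<psi> \<subseteq> carrier Q \<times> carrier Q"
  shows "pullback M h \<psi> \<subseteq> pullback M h \<psi>' \<longleftrightarrow> \<psi> \<subseteq> \<psi>'"
proof
  assume a: "pullback M h \<psi> \<subseteq> pullback M h \<psi>'"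
  show "\<psi> \<subseteq> \<psi>'"
  proof
    fix p assume p: "p \<in> \<psi>"
    then have "fst p \<in> h ` carrier M" "snd p \<in> h ` carrier M" using assms surj by auto
    then obtain x y where "p = (h x, h y)" "x \<in> carrier M" "y \<in> carrier M"
      by (metis imageE prod.collapse)
    then show "p \<in> \<psi>'" using a p by (auto simp: pullback_def)
  qed
qed (rule pullback_mono)

lemma Ker_subset_pullback: "\<psi> \<in> Con F Q \<Longrightarrow> Ker M Q h \<subseteq> pullback M h \<psi>"
  using Con_refl[of \<psi> F Q] by (auto simp: Ker_def pullback_def)

text \<open>The correspondence theorem, with the direct image of \<phi> as witness. Everything rests
  on \<open>mem\<close>: since \<phi> contains the kernel, membership in the image does not depend
  on the chosen preimages.\<close>

lemma Con_above_Ker: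
  assumes \<phi>: "\<phi> \<in> Con F M" and ker: "Ker M Q h \<subseteq> \<phi>"
  obtains \<psi> where "\<psi> \<in> Con F Q" "pullback M h \<psi> = \<phi>"
proof -
  let ?\<psi> = "map_prod h h ` \<phi>"
  have k: "(x, y) \<in> \<phi>" if "x \<in> carrier M" "y \<in> carrier M" "h x = h y" for x y
  proof -
    have "h y \<in> carrier Q" using that surj by blast
    then show ?thesis using that ker by (auto simp: Ker_def pullback_def)
  qed
  have mem: "(h x, h y) \<in> ?\<psi> \<longleftrightarrow> (x, y) \<in> \<phi>" if xy: "x \<in> carrier M" "y \<in> carrier M" for x y
  proof
    assume "(h x, h y) \<in> ?\<psi>"
    then obtain x' y' where x'y': "(x', y') \<in> \<phi>" "h x = h x'" "h y = h y'" by auto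
    then have "(x, x') \<in> \<phi>" "(y', y) \<in> \<phi>" using k xy Con_carrier[OF \<phi> x'y'(1)] by auto
    then show "(x, y) \<in> \<phi>" using x'y'(1) Con_trans[OF \<phi>] by blast
  qed auto
  have sub: "?\<psi> \<subseteq> carrier Q \<times> carrier Q" using Con_sub[OF \<phi>] surj by fastforce
  have "equiv (carrier Q) ?\<psi>"
  proof (rule equivI[OF sub])
    show "refl_on (carrier Q) ?\<psi>"
      unfolding refl_on_def surj[symmetric] using mem Con_refl[OF \<phi>] by blast
    show "sym ?\<psi>" using Con_sym[OF \<phi>] by (fastforce simp: sym_def)
    show "trans ?\<psi>"
    proof (rule transI)
      fix x y z assume xy: "(x, y) \<in> ?\<psi>" and yz: "(y, z) \<in> ?\<psi>"
      have "x \<in> h ` carrier M" "y \<in> h ` carrier M" "z \<in> h ` carrier M"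
        using subsetD[OF sub xy] subsetD[OF sub yz] surj by auto
      then obtain a b c where abc: "a \<in> carrier M" "b \<in> carrier M" "c \<in> carrier M"
        "x = h a" "y = h b" "z = h c" by blast
      then have "(a, b) \<in> \<phi>" "(b, c) \<in> \<phi>" using xy yz mem by simp_all
      then have "(a, c) \<in> \<phi>" by (rule Con_trans[OF \<phi>])
      then show "(x, z) \<in> ?\<psi>" using mem abc by simp
    qed
  qed
  moreover have "(opr Q g xs, opr Q g ys) \<in> ?\<psi>"
    if g: "(g, length xs) \<in> F" and l: "list_all2 (\<lambda>x y. (x, y) \<in> ?\<psi>) xs ys" for g xs ys
  proof -
    have len: "length ys = length xs" using list_all2_lengthD[OF l] by simp
    have "set xs \<subseteq> h ` carrier M" "set ys \<subseteq> h ` carrier M"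
      using list_all2_rel_sub[OF l sub] surj by auto
    then have "xs \<in> lists (h ` carrier M)" "ys \<in> lists (h ` carrier M)" by auto
    then obtain us vs where uv: "xs = map h us" "set us \<subseteq> carrier M" "ys = map h vs" "set vs \<subseteq> carrier M"
      unfolding lists_image by auto
    have "list_all2 (\<lambda>u v. (u, v) \<in> \<phi>) us vs"
    proof (rule list_all2_all_nthI)
      show l': "length us = length vs" using len uv by simp
      fix i assume i: "i < length us"
      then have "(h (us ! i), h (vs ! i)) \<in> ?\<psi>" using list_all2_nthD[OF l, of i] uv l' by (simp only: nth_map length_map)
      moreover have "us ! i \<in> carrier M" "vs ! i \<in> carrier M" using uv i l' by (auto simp: subset_iff)
      ultimately show "(us ! i, vs ! i) \<in> \<phi>" by (simp only: mem)
    qed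
    then have "(opr M g us, opr M g vs) \<in> \<phi>" using Con_opr[OF \<phi>] g uv by simp
    then have "(h (opr M g us), h (opr M g vs)) \<in> ?\<psi>" by auto
    then show ?thesis using hom_opr uv g len by simp
  qed
  ultimately have "?\<psi> \<in> Con F Q" unfolding Con_def by blast
  moreover have "p \<in> pullback M h ?\<psi> \<longleftrightarrow> p \<in> \<phi>" for p
    using mem[of "fst p" "snd p"] Con_carrier[OF \<phi>, of "fst p" "snd p"]
    by (auto simp: pullback_def case_prod_beta simp del: map_prod_imageI)
  ultimately show thesis using that[of ?\<psi>] by (simp add: set_eq_iff)
qed

text \<open>Evaluation commutes with \<open>h\<close>. Arguments in \<open>M\<close> are mapped down
  by \<open>h\<close>, and arguments in \<open>Q\<close> are lifted along a right inverse of
  \<open>h\<close>.\<close>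

lemma term_condition_pullback:
  assumes \<alpha>: "\<alpha> \<in> Con F Q" and \<beta>: "\<beta> \<in> Con F Q"
  shows "term_condition F Q \<alpha> \<beta> \<delta>
    \<longleftrightarrow> term_condition F M (pullback M h \<alpha>) (pullback M h \<beta>) (pullback M h \<delta>)"
proof
  assume tc: "term_condition F Q \<alpha> \<beta> \<delta>"
  show "term_condition F M (pullback M h \<alpha>) (pullback M h \<beta>) (pullback M h \<delta>)"
    unfolding term_condition_def
  proof (intro allI impI, elim conjE)
    fix t :: "('f, nat + nat) trm" and a b c d :: "nat \<Rightarrow> 'a"
    assume t: "wf_trm F t" and ab: "\<forall>i. (a i, b i) \<in> pullback M h \<alpha>"
      and cd: "\<forall>j. (c j, d j) \<in> pullback M h \<beta>"
      and \<delta>: "(eval M (case_sum a c) t, eval M (case_sum a d) t) \<in> pullback M h \<delta>"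
    have C: "range a \<subseteq> carrier M" "range b \<subseteq> carrier M" "range c \<subseteq> carrier M" "range d \<subseteq> carrier M"
      using ab cd by (auto simp: pullback_def)
    have ev: "h (eval M (case_sum x y) t) = eval Q (case_sum (h \<circ> x) (h \<circ> y)) t"
        "eval M (case_sum x y) t \<in> carrier M"
      if "range x \<subseteq> carrier M" "range y \<subseteq> carrier M" for x y
    proof -
      have r: "range (case_sum x y) \<subseteq> carrier M" using that by (auto simp: image_subset_iff split: sum.split)
      have "h \<circ> case_sum x y = case_sum (h \<circ> x) (h \<circ> y)" by (auto simp: fun_eq_iff split: sum.split)
      then show "h (eval M (case_sum x y) t) = eval Q (case_sum (h \<circ> x) (h \<circ> y)) t"
        using eval_hom[OF hom M r t] by simp
      show "eval M (case_sum x y) t \<in> carrier M" by (rule eval_closed[OF M r t])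
    qed
    have "(eval Q (case_sum (h \<circ> b) (h \<circ> c)) t, eval Q (case_sum (h \<circ> b) (h \<circ> d)) t) \<in> \<delta>"
      using tc[unfolded term_condition_def, rule_format, of t "h \<circ> a" "h \<circ> b" "h \<circ> c" "h \<circ> d"]
        t ab cd \<delta> ev C by (simp add: pullback_def)
    then show "(eval M (case_sum b c) t, eval M (case_sum b d) t) \<in> pullback M h \<delta>"
      using ev C by (simp add: pullback_def)
  qed
next
  assume tc: "term_condition F M (pullback M h \<alpha>) (pullback M h \<beta>) (pullback M h \<delta>)"
  show "term_condition F Q \<alpha> \<beta> \<delta>"
    unfolding term_condition_def
  proof (intro allI impI, elim conjE)
    fix t :: "('f, nat + nat) trm" and a b c d :: "nat \<Rightarrow> 'b"
    assume t: "wf_trm F t" and ab: "\<forall>i. (a i, b i) \<in> \<alpha>" and cd: "\<forall>j. (c j, d j) \<in> \<beta>"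
      and \<delta>: "(eval Q (case_sum a c) t, eval Q (case_sum a d) t) \<in> \<delta>"
    let ?s = "inv_into (carrier M) h"
    have s: "?s y \<in> carrier M" "h (?s y) = y" if "y \<in> carrier Q" for y
      using that surj inv_into_into f_inv_into_f by (metis+)
    have C: "a i \<in> carrier Q" "b i \<in> carrier Q" "c i \<in> carrier Q" "d i \<in> carrier Q" for i
      using ab cd Con_carrier[OF \<alpha>] Con_carrier[OF \<beta>] by blast+
    have ev: "h (eval M (case_sum (?s \<circ> x) (?s \<circ> y)) t) = eval Q (case_sum x y) t"
        "eval M (case_sum (?s \<circ> x) (?s \<circ> y)) t \<in> carrier M"
      if "\<And>i. x i \<in> carrier Q" "\<And>i. y i \<in> carrier Q" for x y
    proof -
      have r: "range (case_sum (?s \<circ> x) (?s \<circ> y)) \<subseteq> carrier M"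
        using that s by (auto split: sum.splits)
      have "h \<circ> case_sum (?s \<circ> x) (?s \<circ> y) = case_sum x y"
        using that s by (auto simp: fun_eq_iff split: sum.split)
      then show "h (eval M (case_sum (?s \<circ> x) (?s \<circ> y)) t) = eval Q (case_sum x y) t"
        using eval_hom[OF hom M r t] by simp
      show "eval M (case_sum (?s \<circ> x) (?s \<circ> y)) t \<in> carrier M" by (rule eval_closed[OF M r t])
    qed
    have "(eval M (case_sum (?s \<circ> b) (?s \<circ> c)) t, eval M (case_sum (?s \<circ> b) (?s \<circ> d)) t) \<in> pullback M h \<delta>"
      using tc[unfolded term_condition_def, rule_format, of t "?s \<circ> a" "?s \<circ> b" "?s \<circ> c" "?s \<circ> d"]
        t ab cd \<delta> ev C s by (simp add: pullback_def)
    then show "(eval Q (case_sum b c) t, eval Q (case_sum b d) t) \<in> \<delta>"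
      using ev C by (simp add: pullback_def)
  qed
qed

lemma pullback_full_iff:
  assumes "\<psi> \<in> Con F Q"
  shows "pullback M h \<psi> = carrier M \<times> carrier M \<longleftrightarrow> \<psi> = carrier Q \<times> carrier Q"
proof -
  have full: "pullback M h (carrier Q \<times> carrier Q) = carrier M \<times> carrier M"
    using surj by (auto simp: pullback_def)
  show ?thesis
    using pullback_subset_iff[of \<psi> "carrier Q \<times> carrier Q"] pullback_subset_iff[of "carrier Q \<times> carrier Q" \<psi>]
      Con_sub[OF assms] unfolding full by blast
qed

text \<open>Congruences of \<open>Q\<close> only account for congruences of \<open>M\<close> above
  the kernel. For primeness in \<open>M\<close>, arbitrary \<alpha> and \<beta> are therefore first
  enlarged by the kernel, which the term condition for \<open>?p \<psi>\<close> tolerates thanks to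
  modularity.\<close>

lemma Spec_pullback_iff:
  assumes E: "E \<subseteq> identities F" "congruence_modular F E" "M \<in> variety F E" and \<psi>: "\<psi> \<in> Con F Q"
  shows "pullback M h \<psi> \<in> Spec F M \<longleftrightarrow> \<psi> \<in> Spec F Q"
proof
  let ?p = "pullback M h"
  assume S: "?p \<psi> \<in> Spec F M"
  have "\<alpha> \<subseteq> \<psi> \<or> \<beta> \<subseteq> \<psi>"
    if \<alpha>: "\<alpha> \<in> Con F Q" and \<beta>: "\<beta> \<in> Con F Q" and c: "commutator F Q \<alpha> \<beta> \<subseteq> \<psi>" for \<alpha> \<beta>
  proof -
    note cs = commutator_smallest[OF algebra_Q \<alpha> \<beta>]
    \<comment> \<open>The inverse image of the commutator of \<open>Q\<close> satisfies the term
      condition in \<open>M\<close>, so it contains the smallest such congruence.\<close>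
    have "commutator F M (?p \<alpha>) (?p \<beta>) \<subseteq> ?p (commutator F Q \<alpha> \<beta>)"
      using commutator_smallest(3)[OF M pullback_Con[OF \<alpha>] pullback_Con[OF \<beta>] pullback_Con[OF cs(1)]]
        cs(2) term_condition_pullback[OF \<alpha> \<beta>] by blast
    also have "\<dots> \<subseteq> ?p \<psi>" using c by (rule pullback_mono)
    finally have "?p \<alpha> \<subseteq> ?p \<psi> \<or> ?p \<beta> \<subseteq> ?p \<psi>"
      using S pullback_Con \<alpha> \<beta> by (simp add: Spec_def)
    then show ?thesis using pullback_subset_iff Con_sub[OF \<alpha>] Con_sub[OF \<beta>] by blast
  qed
  then show "\<psi> \<in> Spec F Q" using S \<psi> pullback_full_iff[OF \<psi>] by (simp add: Spec_def)
next
  let ?p = "pullback M h" and ?\<theta> = "Ker M Q h"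
  assume S: "\<psi> \<in> Spec F Q"
  note \<phi> = pullback_Con[OF \<psi>] and ker = Ker_subset_pullback[OF \<psi>]
  have \<theta>: "?\<theta> \<in> Con F M"
    unfolding Ker_def by (rule pullback_Con[OF Id_in_Con[OF algebra_Q]])
  have mod: "con_modular F (pair_alg M \<beta>)" if "\<beta> \<in> Con F M" for \<beta>
    using congruence_modular_con_modular[OF E(1,2)] pair_alg_variety[OF E(1,3) that] .
  \<comment> \<open>Joins with the kernel in the first argument and then swaps the arguments; used
    twice, it enlarges both and restores their order.\<close>
  have join: "term_condition F M \<beta> (Cg F M (\<alpha> \<union> ?\<theta>)) (?p \<psi>)"
    if \<alpha>: "\<alpha> \<in> Con F M" and \<beta>: "\<beta> \<in> Con F M" and tc: "term_condition F M \<alpha> \<beta> (?p \<psi>)" for \<alpha> \<beta>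
    by (rule term_condition_sym[OF M mod Con_join[OF M \<alpha> \<theta>] \<beta> \<phi>], rule \<beta>)
      (rule term_condition_join[OF M \<alpha> \<theta> \<beta> tc term_condition_trivial[OF M \<theta> \<beta> \<phi> ker]])
  have "\<alpha> \<subseteq> ?p \<psi> \<or> \<beta> \<subseteq> ?p \<psi>"
    if \<alpha>: "\<alpha> \<in> Con F M" and \<beta>: "\<beta> \<in> Con F M" and c: "commutator F M \<alpha> \<beta> \<subseteq> ?p \<psi>" for \<alpha> \<beta>
  proof -
    let ?\<alpha> = "Cg F M (\<alpha> \<union> ?\<theta>)" and ?\<beta> = "Cg F M (\<beta> \<union> ?\<theta>)"
    note cs = commutator_smallest[OF M \<alpha> \<beta>]
    note \<alpha>' = Con_join[OF M \<alpha> \<theta>] and \<beta>' = Con_join[OF M \<beta> \<theta>]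
    \<comment> \<open>The commutator satisfies the term condition; monotonicity passes this on to
      the larger congruence \<open>?p \<psi>\<close>.\<close>
    have "term_condition F M \<alpha> \<beta> (?p \<psi>)"
      by (rule term_condition_mono[OF M mod[OF \<beta>] \<alpha> \<beta> cs(1,2) \<phi> c])
    then have tc: "term_condition F M ?\<alpha> ?\<beta> (?p \<psi>)"
      by (rule join[OF \<beta> \<alpha>' join[OF \<alpha> \<beta>]])
    have up: "\<alpha> \<subseteq> ?\<alpha>" "?\<theta> \<subseteq> ?\<alpha>" "\<beta> \<subseteq> ?\<beta>" "?\<theta> \<subseteq> ?\<beta>"
      using Cg_upper[of "\<alpha> \<union> ?\<theta>" F M] Cg_upper[of "\<beta> \<union> ?\<theta>" F M] by auto
    obtain \<gamma> \<delta> where \<gamma>: "\<gamma> \<in> Con F Q" "?p \<gamma> = ?\<alpha>" and \<delta>: "\<delta> \<in> Con F Q" "?p \<delta> = ?\<beta>"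
      using Con_above_Ker[OF \<alpha>' up(2)] Con_above_Ker[OF \<beta>' up(4)] by metis
    have "term_condition F Q \<gamma> \<delta> \<psi>"
      using tc term_condition_pullback[OF \<gamma>(1) \<delta>(1)] \<gamma>(2) \<delta>(2) by simp
    then have "commutator F Q \<gamma> \<delta> \<subseteq> \<psi>"
      by (rule commutator_smallest(3)[OF algebra_Q \<gamma>(1) \<delta>(1) \<psi>])
    then have "\<gamma> \<subseteq> \<psi> \<or> \<delta> \<subseteq> \<psi>" using S \<gamma>(1) \<delta>(1) by (simp add: Spec_def)
    then have "?p \<gamma> \<subseteq> ?p \<psi> \<or> ?p \<delta> \<subseteq> ?p \<psi>" using pullback_mono by blast
    then show ?thesis using up \<gamma>(2) \<delta>(2) by blast
  qed
  then show "?p \<psi> \<in> Spec F M" using S \<phi> pullback_full_iff[OF \<psi>] by (simp add: Spec_def)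
qed

end


section \<open>Going Up\<close>

lemma quot_hom:
  assumes "algebra F M" "\<theta> \<in> Con F M"
  shows "surjective_hom F M (quot_alg M \<theta>) (\<lambda>x. \<theta> `` {x})"
proof
  show "is_hom F M (quot_alg M \<theta>) (\<lambda>x. \<theta> `` {x})"
    using quot_alg_opr[OF assms(2)] by (auto simp: is_hom_def quot_alg_carrier)
qed (simp_all add: assms quot_alg_carrier)

lemma Ker_quot:
  assumes "\<theta> \<in> Con F M"
  shows "Ker M (quot_alg M \<theta>) (\<lambda>x. \<theta> `` {x}) = \<theta>"
proof -
  have eq: "p \<in> Ker M (quot_alg M \<theta>) (\<lambda>x. \<theta> `` {x}) \<longleftrightarrow> p \<in> \<theta>" for p
  proof (cases p)
    case (Pair x y)
    have "p \<in> Ker M (quot_alg M \<theta>) (\<lambda>x. \<theta> `` {x}) \<longleftrightarrow>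
        x \<in> carrier M \<and> y \<in> carrier M \<and> \<theta> `` {x} = \<theta> `` {y}"
      by (simp add: Pair Ker_def pullback_def quot_alg_carrier Id_on_iff) (metis imageI)
    also have "\<dots> \<longleftrightarrow> p \<in> \<theta>"
      using eq_equiv_class_iff[OF Con_equiv[OF assms], of x y] Con_carrier[OF assms, of x y] Pair by metis
    finally show ?thesis .
  qed
  show ?thesis using eq by blast
qed

lemma push_in_Con:
  assumes "algebra F B" "is_hom F A B f" "\<theta> \<in> Con F A"
  shows "push F B f \<theta> \<in> Con F B"
  unfolding push_def
  by (rule Cg_in_Con[OF assms(1)]) (use Con_sub[OF assms(3)] assms(2) in \<open>fastforce simp: is_hom_def\<close>)

text \<open>The adjunction between \<open>push\<close> and inverse image: primes of \<open>B\<close>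
  above \<open>push F B f \<theta>\<close> are those whose inverse image contains \<theta>.\<close>

lemma push_subset_iff:
  assumes "\<theta> \<in> Con F A" "\<psi> \<in> Con F B"
  shows "push F B f \<theta> \<subseteq> \<psi> \<longleftrightarrow> \<theta> \<subseteq> pullback A f \<psi>"
proof
  assume "push F B f \<theta> \<subseteq> \<psi>"
  then have "map_prod f f ` \<theta> \<subseteq> \<psi>" using Cg_upper unfolding push_def by blast
  then show "\<theta> \<subseteq> pullback A f \<psi>" using Con_sub[OF assms(1)] by (auto simp: pullback_def)
next
  assume "\<theta> \<subseteq> pullback A f \<psi>"
  then show "push F B f \<theta> \<subseteq> \<psi>"
    unfolding push_def by (intro Cg_least[OF assms(2)]) (auto simp: pullback_def)
qed

lemma induced_hom:
  assumes A: "algebra F A" and B: "algebra F B" and f: "is_hom F A B f" and \<theta>: "\<theta> \<in> Con F A"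
  shows "is_hom F (quot_alg A \<theta>) (quot_alg B (push F B f \<theta>)) (induced F B f \<theta>)"
  unfolding is_hom_def
proof (intro conjI allI impI)
  let ?\<chi> = "push F B f \<theta>"
  interpret A: surjective_hom F A "quot_alg A \<theta>" "\<lambda>x. \<theta> `` {x}" by (rule quot_hom[OF A \<theta>])
  note ind = induced_class[OF f B \<theta>] and \<chi> = push_in_Con[OF B f \<theta>]
  have fC: "f x \<in> carrier B" if "x \<in> carrier A" for x using f that by (auto simp: is_hom_def)
  show "induced F B f \<theta> ` carrier (quot_alg A \<theta>) \<subseteq> carrier (quot_alg B ?\<chi>)"
    using ind fC by (auto simp: quot_alg_carrier simp del: Image_singleton_iff)
  fix g Xs assume a: "(g, length Xs) \<in> F \<and> set Xs \<subseteq> carrier (quot_alg A \<theta>)"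
  then have "Xs \<in> lists ((\<lambda>x. \<theta> `` {x}) ` carrier A)" by (auto simp: quot_alg_carrier)
  then obtain xs where xs: "Xs = map (\<lambda>x. \<theta> `` {x}) xs" "set xs \<subseteq> carrier A"
    unfolding lists_image by auto
  have "opr A g xs \<in> carrier A" using A a xs by (simp add: algebra_def)
  then have "induced F B f \<theta> (opr (quot_alg A \<theta>) g Xs) = ?\<chi> `` {f (opr A g xs)}"
    using ind quot_alg_opr[OF \<theta>, of g xs] a xs by simp
  also have "f (opr A g xs) = opr B g (map f xs)" using f a xs by (simp add: is_hom_def)
  also have "?\<chi> `` {opr B g (map f xs)} = opr (quot_alg B ?\<chi>) g (map (\<lambda>y. ?\<chi> `` {y}) (map f xs))"
    using quot_alg_opr[OF \<chi>, of g "map f xs"] a xs fC by auto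
  also have "map (\<lambda>y. ?\<chi> `` {y}) (map f xs) = map (induced F B f \<theta>) Xs"
    using ind xs by auto
  finally show "induced F B f \<theta> (opr (quot_alg A \<theta>) g Xs)
    = opr (quot_alg B ?\<chi>) g (map (induced F B f \<theta>) Xs)" .
qed

text \<open>Commutativity of the square formed by \<open>f\<close>, the induced morphism and the two
  projections, read on inverse images.\<close>

lemma pullback_induced:
  assumes "algebra F B" "is_hom F A B f" "\<theta> \<in> Con F A"
  shows "pullback A (\<lambda>x. \<theta> `` {x}) (pullback (quot_alg A \<theta>) (induced F B f \<theta>) \<psi>)
    = pullback A f (pullback B (\<lambda>y. push F B f \<theta> `` {y}) \<psi>)"
proof -
  have "\<theta> `` {x} \<in> carrier (quot_alg A \<theta>)" "f x \<in> carrier B" if "x \<in> carrier A" for x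
    using that assms(2) by (auto simp: quot_alg_carrier is_hom_def)
  then show ?thesis
    using induced_class[OF assms(2,1,3)]
    by (auto simp: pullback_def simp del: Image_singleton_iff)
qed

text \<open>Zorn's lemma for reverse inclusion among the primes below \<phi>; a non-empty chain is
  bounded by its intersection, which is again prime.\<close>

lemma Min_below:
  assumes \<phi>: "\<phi> \<in> Spec F M"
  obtains \<mu> where "\<mu> \<in> MinSpec F M" "\<mu> \<subseteq> \<phi>"
proof -
  let ?S = "{\<psi> \<in> Spec F M. \<psi> \<subseteq> \<phi>}"
  have "\<exists>m \<in> ?S. \<forall>s \<in> ?S. (\<lambda>x y. y \<subseteq> x) m s \<longrightarrow> s = m"
  proof (rule predicate_Zorn)
    show "partial_order_on ?S (relation_of (\<lambda>x y. y \<subseteq> x) ?S)"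
      by (rule partial_order_on_relation_ofI) auto
    fix C assume "C \<in> Chains (relation_of (\<lambda>x y. y \<subseteq> x) ?S)"
    then have C: "C \<subseteq> ?S" and chain: "\<And>x y. x \<in> C \<Longrightarrow> y \<in> C \<Longrightarrow> y \<subseteq> x \<or> x \<subseteq> y"
      by (auto simp: Chains_def relation_of_def)
    show "\<exists>u \<in> ?S. \<forall>a \<in> C. u \<subseteq> a"
    proof (cases "C = {}")
      case True
      then show ?thesis using \<phi> by blast
    next
      case False
      have CS: "C \<subseteq> Spec F M" using C by blast
      then have Con: "\<Inter>C \<in> Con F M" using False by (intro Inter_in_Con) (auto simp: Spec_def)
      obtain \<rho> where \<rho>: "\<rho> \<in> C" using False by blast
      then have "\<rho> \<noteq> carrier M \<times> carrier M" "\<rho> \<subseteq> carrier M \<times> carrier M"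
        using CS Con_sub[of \<rho> F M] unfolding Spec_def by blast+
      then have "\<Inter>C \<noteq> carrier M \<times> carrier M" using \<rho> by blast
      moreover have "\<alpha> \<subseteq> \<Inter>C \<or> \<beta> \<subseteq> \<Inter>C"
        if \<alpha>: "\<alpha> \<in> Con F M" and \<beta>: "\<beta> \<in> Con F M" and c: "commutator F M \<alpha> \<beta> \<subseteq> \<Inter>C" for \<alpha> \<beta>
      proof (rule ccontr)
        assume "\<not> (\<alpha> \<subseteq> \<Inter>C \<or> \<beta> \<subseteq> \<Inter>C)"
        then obtain \<sigma> \<tau> where st: "\<sigma> \<in> C" "\<not> \<alpha> \<subseteq> \<sigma>" "\<tau> \<in> C" "\<not> \<beta> \<subseteq> \<tau>" by blast
        have prime: "\<alpha> \<subseteq> \<rho> \<or> \<beta> \<subseteq> \<rho>" if "\<rho> \<in> C" for \<rho>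
          using subsetD[OF CS that] \<alpha> \<beta> c that unfolding Spec_def by blast
        \<comment> \<open>The smaller of \<sigma> and \<tau> contains the commutator, but neither
          \<alpha> nor \<beta>.\<close>
        show False using prime[OF st(1)] prime[OF st(3)] chain[OF st(1,3)] st by blast
      qed
      ultimately have "\<Inter>C \<in> Spec F M" using Con by (simp add: Spec_def)
      moreover have "\<Inter>C \<subseteq> \<phi>" using \<rho> C by blast
      ultimately show ?thesis by blast
    qed
  qed
  then obtain \<mu> where \<mu>: "\<mu> \<in> ?S" "\<forall>\<psi> \<in> ?S. \<psi> \<subseteq> \<mu> \<longrightarrow> \<psi> = \<mu>" by (elim bexE)
  have "\<psi> = \<mu>" if "\<psi> \<in> Spec F M" "\<psi> \<subseteq> \<mu>" for \<psi>
    using \<mu> that order_trans[of \<psi> \<mu> \<phi>] by simp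
  then have "\<mu> \<in> MinSpec F M" "\<mu> \<subseteq> \<phi>" using \<mu>(1) by (simp_all add: MinSpec_def)
  then show thesis by (rule that)
qed

text \<open>The maps \<open>?p\<close> and \<open>?q\<close> identify the primes of the quotients
  with the primes of \<open>A\<close> above \<theta> and of \<open>B\<close> above
  \<open>?\<chi>\<close>, preserving and reflecting inclusion, and \<open>comm\<close> matches the
  inverse images. The prime \<phi> of Going Up disappears, being the inverse image of
  \<open>\<phi>\<^sub>1\<close>.\<close>

lemma GU_induced_iff:
  fixes F :: "('f \<times> nat) set" and A :: "('a, 'f) ualg" and B :: "('b, 'f) ualg"
  assumes E: "E \<subseteq> identities F" "congruence_modular F E" "A \<in> variety F E" "B \<in> variety F E"
    and f: "is_hom F A B f" and adm: "admissible F A B f" and \<theta>: "\<theta> \<in> Con F A"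
  shows "GU_induced F A B f \<theta> \<longleftrightarrow> (\<forall>\<psi> \<in> Spec F A. \<forall>\<phi>\<^sub>1 \<in> Spec F B.
    \<theta> \<subseteq> pullback A f \<phi>\<^sub>1 \<and> pullback A f \<phi>\<^sub>1 \<subseteq> \<psi> \<longrightarrow>
    (\<exists>\<psi>\<^sub>1 \<in> Spec F B. \<phi>\<^sub>1 \<subseteq> \<psi>\<^sub>1 \<and> pullback A f \<psi>\<^sub>1 = \<psi>))" (is "_ \<longleftrightarrow> ?R")
proof -
  let ?\<chi> = "push F B f \<theta>" and ?g = "induced F B f \<theta>"
  let ?A = "quot_alg A \<theta>" and ?B = "quot_alg B ?\<chi>"
  let ?p = "pullback A (\<lambda>x. \<theta> `` {x})" and ?q = "pullback B (\<lambda>y. ?\<chi> `` {y})"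
  let ?f = "pullback A f" and ?gs = "pullback ?A ?g"
  have AB: "algebra F A" "algebra F B" using E by (auto simp: variety_def)
  have \<chi>: "?\<chi> \<in> Con F B" by (rule push_in_Con[OF AB(2) f \<theta>])
  interpret A: surjective_hom F A ?A "\<lambda>x. \<theta> `` {x}" by (rule quot_hom[OF AB(1) \<theta>])
  interpret B: surjective_hom F B ?B "\<lambda>y. ?\<chi> `` {y}" by (rule quot_hom[OF AB(2) \<chi>])
  have SC: "\<psi> \<in> Con F M" if "\<psi> \<in> Spec F M" for \<psi> and M :: "('d, 'f) ualg"
    using that by (simp add: Spec_def)
  have SCA: "\<psi> \<in> Con F ?A" if "\<psi> \<in> Spec F ?A" for \<psi> using that by (simp add: Spec_def)
  have SCB: "\<psi> \<in> Con F ?B" if "\<psi> \<in> Spec F ?B" for \<psi> using that by (simp add: Spec_def)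
  have comm: "?p (?gs \<psi>) = ?f (?q \<psi>)" for \<psi>
    by (rule pullback_induced[OF AB(2) f \<theta>])
  have g: "?gs \<psi> \<in> Con F ?A" if "\<psi> \<in> Con F ?B" for \<psi>
    by (rule pullback_in_Con[OF induced_hom[OF AB f \<theta>] A.algebra_Q that])
  have pS: "?p \<psi> \<in> Spec F A \<longleftrightarrow> \<psi> \<in> Spec F ?A" if "\<psi> \<in> Con F ?A" for \<psi>
    by (rule A.Spec_pullback_iff[OF E(1-3) that])
  have qS: "?q \<psi> \<in> Spec F B \<longleftrightarrow> \<psi> \<in> Spec F ?B" if "\<psi> \<in> Con F ?B" for \<psi>
    by (rule B.Spec_pullback_iff[OF E(1,2,4) that])
  have p_le: "?p \<psi> \<subseteq> ?p \<psi>' \<longleftrightarrow> \<psi> \<subseteq> \<psi>'" if "\<psi> \<in> Con F ?A" for \<psi> \<psi>'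
    by (rule A.pullback_subset_iff[OF Con_sub[OF that]])
  have q_le: "?q \<psi> \<subseteq> ?q \<psi>' \<longleftrightarrow> \<psi> \<subseteq> \<psi>'" if "\<psi> \<in> Con F ?B" for \<psi> \<psi>'
    by (rule B.pullback_subset_iff[OF Con_sub[OF that]])
  have p_above: "\<exists>\<psi>' \<in> Spec F ?A. ?p \<psi>' = \<psi>" if "\<psi> \<in> Spec F A" "\<theta> \<subseteq> \<psi>" for \<psi>
    using A.Con_above_Ker[of \<psi>] that SC Ker_quot[OF \<theta>] pS by (metis (no_types, lifting))
  have q_above: "\<exists>\<psi>' \<in> Spec F ?B. ?q \<psi>' = \<psi>" if "\<psi> \<in> Spec F B" "?\<chi> \<subseteq> \<psi>" for \<psi>
    using B.Con_above_Ker[of \<psi>] that SC Ker_quot[OF \<chi>] qS by (metis (no_types, lifting))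
  have \<chi>_le: "?\<chi> \<subseteq> \<psi> \<longleftrightarrow> \<theta> \<subseteq> ?f \<psi>" if "\<psi> \<in> Con F B" for \<psi>
    by (rule push_subset_iff[OF \<theta> that])
  have q_ker: "?\<chi> \<subseteq> ?q \<psi>" if "\<psi> \<in> Con F ?B" for \<psi>
    using B.Ker_subset_pullback[OF that] Ker_quot[OF \<chi>] by simp
  have gS: "?gs \<psi> \<in> Spec F ?A" if \<psi>: "\<psi> \<in> Spec F ?B" for \<psi>
  proof -
    have "?q \<psi> \<in> Spec F B" using qS SCB[OF \<psi>] \<psi> by blast
    then have "?p (?gs \<psi>) \<in> Spec F A" using adm comm by (simp add: admissible_def)
    then show ?thesis using pS g SCB[OF \<psi>] by blast
  qed
  then have gadm: "admissible F ?A ?B ?g" by (simp add: admissible_def)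
  show ?thesis
  proof
    assume GU: "GU_induced F A B f \<theta>"
    show ?R
    proof (intro ballI impI, elim conjE)
      fix \<psi> \<phi>\<^sub>1
      assume \<psi>: "\<psi> \<in> Spec F A" and \<phi>1: "\<phi>\<^sub>1 \<in> Spec F B" and le: "\<theta> \<subseteq> ?f \<phi>\<^sub>1" "?f \<phi>\<^sub>1 \<subseteq> \<psi>"
      obtain \<psi>' where \<psi>': "\<psi>' \<in> Spec F ?A" "?p \<psi>' = \<psi>" using p_above[OF \<psi>] le by blast
      obtain \<phi>' where \<phi>': "\<phi>' \<in> Spec F ?B" "?q \<phi>' = \<phi>\<^sub>1"
        using q_above[OF \<phi>1] \<chi>_le[OF SC[OF \<phi>1]] le(1) by blast
      have "?gs \<phi>' \<subseteq> \<psi>'"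
        using p_le[OF g[OF SCB[OF \<phi>'(1)]], of \<psi>'] comm[of \<phi>'] \<phi>'(2) \<psi>'(2) le(2) by simp
      then obtain \<psi>1 where \<psi>1: "\<psi>1 \<in> Spec F ?B" "\<phi>' \<subseteq> \<psi>1" "?gs \<psi>1 = \<psi>'"
        using GU gS[OF \<phi>'(1)] \<psi>'(1) \<phi>'(1) unfolding GU_induced_def GU_def by blast
      have "?q \<psi>1 \<in> Spec F B" using qS[OF SCB[OF \<psi>1(1)]] \<psi>1(1) by blast
      moreover have "\<phi>\<^sub>1 \<subseteq> ?q \<psi>1" using q_le[OF SCB[OF \<phi>'(1)]] \<phi>'(2) \<psi>1(2) by blast
      moreover have "?f (?q \<psi>1) = \<psi>" using comm[of \<psi>1] \<psi>1(3) \<psi>'(2) by simp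
      ultimately show "\<exists>\<psi>\<^sub>1 \<in> Spec F B. \<phi>\<^sub>1 \<subseteq> \<psi>\<^sub>1 \<and> ?f \<psi>\<^sub>1 = \<psi>" by blast
    qed
  next
    assume R: ?R
    show "GU_induced F A B f \<theta>"
      unfolding GU_induced_def GU_def
    proof (intro conjI gadm ballI impI, elim conjE)
      fix \<phi> \<psi> \<phi>1
      assume \<psi>: "\<psi> \<in> Spec F ?A" and \<phi>1: "\<phi>1 \<in> Spec F ?B" and le: "\<phi> \<subseteq> \<psi>" "?gs \<phi>1 = \<phi>"
      have q\<phi>: "?q \<phi>1 \<in> Spec F B" using qS[OF SCB[OF \<phi>1]] \<phi>1 by blast
      have p\<psi>: "?p \<psi> \<in> Spec F A" using pS[OF SCA[OF \<psi>]] \<psi> by blast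
      have "\<theta> \<subseteq> ?f (?q \<phi>1)" using \<chi>_le[OF SC[OF q\<phi>]] q_ker[OF SCB[OF \<phi>1]] by blast
      moreover have "?f (?q \<phi>1) \<subseteq> ?p \<psi>"
        using comm[of \<phi>1] le pullback_mono[of \<phi> \<psi> A "\<lambda>x. \<theta> `` {x}"] by simp
      ultimately obtain \<psi>1 where \<psi>1: "\<psi>1 \<in> Spec F B" "?q \<phi>1 \<subseteq> \<psi>1" "?f \<psi>1 = ?p \<psi>"
        using R q\<phi> p\<psi> by blast
      \<comment> \<open>Since \<open>\<psi>1\<close> contains \<open>?q \<phi>1\<close> it contains
        \<open>?\<chi>\<close>, and so it comes from a prime of the quotient.\<close>
      obtain \<psi>' where \<psi>': "\<psi>' \<in> Spec F ?B" "?q \<psi>' = \<psi>1"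
        using q_above[OF \<psi>1(1)] q_ker[OF SCB[OF \<phi>1]] \<psi>1(2) by blast
      have "?p (?gs \<psi>') = ?p \<psi>" using comm[of \<psi>'] \<psi>'(2) \<psi>1(3) by simp
      then have "?gs \<psi>' = \<psi>"
        using p_le[OF g[OF SCB[OF \<psi>'(1)]], of \<psi>] p_le[OF SCA[OF \<psi>], of "?gs \<psi>'"] by blast
      moreover have "\<phi>1 \<subseteq> \<psi>'" using q_le[OF SCB[OF \<phi>1], of \<psi>'] \<psi>'(2) \<psi>1(2) by blast
      ultimately show "\<exists>\<psi>\<^sub>1 \<in> Spec F ?B. \<phi>1 \<subseteq> \<psi>\<^sub>1 \<and> ?gs \<psi>\<^sub>1 = \<psi>" using \<psi>'(1) by blast
    qed
  qed
qed

theorem proposition7p10: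
  fixes F :: "('f \<times> nat) set"
    and E :: "(('f, nat) trm \<times> ('f, nat) trm) set"
    and A :: "('a, 'f) ualg"
    and B :: "('b, 'f) ualg"
    and f :: "'a \<Rightarrow> 'b"
  assumes "E \<subseteq> identities F"
    and "congruence_modular F E"
    and "A \<in> variety F E"
    and "B \<in> variety F E"
    and "is_hom F A B f"
    and "admissible F A B f"
  shows "(GU F A B f \<longleftrightarrow> (\<forall>\<theta> \<in> Con F A. GU_induced F A B f \<theta>)) \<and>
         (GU F A B f \<longleftrightarrow> (\<forall>\<theta> \<in> Spec F A. GU_induced F A B f \<theta>)) \<and>
         (GU F A B f \<longleftrightarrow> (\<forall>\<theta> \<in> MinSpec F A. GU_induced F A B f \<theta>)) \<and>
         (GU F A B f \<longleftrightarrow> GU_induced F A B f (Ker A B f))"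
proof -
  note iff = GU_induced_iff[OF assms]
  have AB: "algebra F A" "algebra F B" using assms by (auto simp: variety_def)
  have KC: "Ker A B f \<in> Con F A"
    unfolding Ker_def by (rule pullback_in_Con[OF assms(5) AB(1) Id_in_Con[OF AB(2)]])
  have SC: "Spec F A \<subseteq> Con F A" and MS: "MinSpec F A \<subseteq> Spec F A"
    by (auto simp: Spec_def MinSpec_def)
  \<comment> \<open>Going Up is applied with the inverse image of \<open>\<phi>\<^sub>1\<close> as
    \<phi>, which is prime by admissibility.\<close>
  have down: "GU_induced F A B f \<theta>" if "GU F A B f" "\<theta> \<in> Con F A" for \<theta>
    using that assms(6) unfolding iff[OF that(2)] GU_def admissible_def by blast
  \<comment> \<open>Going Up examines one prime of \<open>B\<close> at a time, so \<theta> may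
    depend on it.\<close>
  have up: "GU F A B f"
    if *: "\<And>\<phi>. \<phi> \<in> Spec F B \<Longrightarrow> \<exists>\<theta> \<in> Con F A. \<theta> \<subseteq> pullback A f \<phi> \<and> GU_induced F A B f \<theta>"
    unfolding GU_def
  proof (intro conjI assms ballI impI, elim conjE)
    fix \<phi> \<psi> \<phi>1
    assume \<psi>: "\<psi> \<in> Spec F A" and \<phi>1: "\<phi>1 \<in> Spec F B" and le: "\<phi> \<subseteq> \<psi>" "pullback A f \<phi>1 = \<phi>"
    obtain \<theta> where \<theta>: "\<theta> \<in> Con F A" "\<theta> \<subseteq> pullback A f \<phi>1" "GU_induced F A B f \<theta>"
      using *[OF \<phi>1] by blast
    show "\<exists>\<psi>\<^sub>1 \<in> Spec F B. \<phi>1 \<subseteq> \<psi>\<^sub>1 \<and> pullback A f \<psi>\<^sub>1 = \<psi>"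
      using \<theta>(3) \<psi> \<phi>1 \<theta>(2) le unfolding iff[OF \<theta>(1)] by blast
  qed
  have adm: "pullback A f \<phi> \<in> Spec F A" if "\<phi> \<in> Spec F B" for \<phi>
    using assms(6) that by (simp add: admissible_def)
  have min: "GU F A B f" if *: "\<forall>\<theta> \<in> MinSpec F A. GU_induced F A B f \<theta>"
  proof (rule up)
    fix \<phi> assume "\<phi> \<in> Spec F B"
    then obtain \<mu> where "\<mu> \<in> MinSpec F A" "\<mu> \<subseteq> pullback A f \<phi>" using Min_below[OF adm] by blast
    then show "\<exists>\<theta> \<in> Con F A. \<theta> \<subseteq> pullback A f \<phi> \<and> GU_induced F A B f \<theta>" using * MS SC by blast
  qed
  have ker: "GU F A B f" if "GU_induced F A B f (Ker A B f)"
  proof (rule up)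
    fix \<phi> assume "\<phi> \<in> Spec F B"
    then have "Id_on (carrier B) \<subseteq> \<phi>" using Con_refl[of \<phi> F B] by (auto simp: Spec_def)
    then have "Ker A B f \<subseteq> pullback A f \<phi>" unfolding Ker_def by (rule pullback_mono)
    then show "\<exists>\<theta> \<in> Con F A. \<theta> \<subseteq> pullback A f \<phi> \<and> GU_induced F A B f \<theta>"
      using KC that by blast
  qed
  \<comment> \<open>The condition for all congruences includes the kernel, and the one for all
    primes includes the minimal primes; so only \<open>ker\<close> and \<open>min\<close> lead back
    to Going Up.\<close>
  show ?thesis
  proof (intro conjI iffI ballI)
    show "GU F A B f" if "\<forall>\<theta> \<in> Con F A. GU_induced F A B f \<theta>" by (rule ker) (use that KC in blast)
    show "GU F A B f" if "\<forall>\<theta> \<in> Spec F A. GU_induced F A B f \<theta>" by (rule min) (use that MS in blast)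
  qed (use down min ker SC MS KC in blast)+
qed

end
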